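(* With the \textsc{Like} mechanism and general (rational non-negative) utilities, for any number of agents, the problem \textsc{NecessaryUtility} is in $\mathrm{P}$. Here \textsc{NecessaryUtility} is the decision problem: given an instance $\mathcal{I}=(A,O,U,o)$ with fixed arrival ordering $o$, an agent $a_i\in A$ and a number $k\in\mathbb{Q}$, decide whether $u_{im}(o)\ge k$.
   Context: Instances. An instance $\mathcal{I}=(A,O,U,o)$ consists of a set $A=\{a_1,\dots,a_n\}$ of agents, a set $O=\{o_1,\dots,o_m\}$ of indivisible items, rational non-negative utilities $u_{ik}$ of agent $a_i$ for item $o_k$ (collected in $U$), and a known ordering $o$ of the $m$ items in which they arrive one at a time. Agents bid sincerely, i.e. agent $a_i$ bids $v_{ik}=u_{ik}$ for item $o_k$. Utilities are additive. \textsc{Like} mechanism. Each arriving item $o_k$ is allocated immediately and irrevocably to an agent chosen uniformly at random among the agents $a_i$ with $v_{ik}>0$; if there are none, nobody receives it. Expected utility. $u_{im}(o)=\sum_{\pi}p(\pi)\,u_i(\pi)$, where $\pi$ ranges over the allocations of the $m$ items that the mechanism can produce when they arrive in the order $o$, $p(\pi)$ is the probability of $\pi$, and $u_i(\pi)$ is the sum of the utilities of $a_i$ for the items it receives in $\pi$. *)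

theory Defs
  imports "HOL-Probability.Probability" "HOL-Computational_Algebra.Polynomial"
begin

section \<open>Allocation instances and the Like mechanism\<close>

text \<open>Agents and items are numbered from 0. Only the values \<open>util I i k\<close> with
  \<open>i < agents I\<close> and \<open>k < items I\<close> are meaningful.\<close>

record alloc_instance =
  agents :: nat
  items :: nat
  util :: "nat \<Rightarrow> nat \<Rightarrow> rat"
  arrival :: "nat list"

definition valid_instance :: "alloc_instance \<Rightarrow> bool" where
  "valid_instance I \<longleftrightarrow>
     (\<forall>i<agents I. \<forall>k<items I. util I i k \<ge> 0) \<and>
     distinct (arrival I) \<and> set (arrival I) = {..<items I}"

type_synonym allocation = "nat \<Rightarrow> nat option"

text \<open>An online mechanism sees the number of agents, the bids and the arrival order.\<close>

type_synonym mechanism = "nat \<Rightarrow> (nat \<Rightarrow> nat \<Rightarrow> rat) \<Rightarrow> nat list \<Rightarrow> allocation pmf"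

definition bidders :: "nat \<Rightarrow> (nat \<Rightarrow> nat \<Rightarrow> rat) \<Rightarrow> nat \<Rightarrow> nat set" where
  "bidders n v k = {i. i < n \<and> v i k > 0}"

definition like_item :: "nat \<Rightarrow> (nat \<Rightarrow> nat \<Rightarrow> rat) \<Rightarrow> nat \<Rightarrow> nat option pmf" where
  "like_item n v k =
     (if bidders n v k = {} then return_pmf None
      else map_pmf Some (pmf_of_set (bidders n v k)))"

fun like_run :: "nat \<Rightarrow> (nat \<Rightarrow> nat \<Rightarrow> rat) \<Rightarrow> nat list \<Rightarrow> allocation \<Rightarrow> allocation pmf" where
  "like_run n v [] \<pi> = return_pmf \<pi>"
| "like_run n v (k # ks) \<pi> =
     bind_pmf (like_item n v k) (\<lambda>r. like_run n v ks (\<pi>(k := r)))"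

definition like :: mechanism where
  "like n v ord = like_run n v ord (\<lambda>_. None)"

definition alloc_utility :: "alloc_instance \<Rightarrow> nat \<Rightarrow> allocation \<Rightarrow> rat" where
  "alloc_utility I i \<pi> = (\<Sum>k | k < items I \<and> \<pi> k = Some i. util I i k)"

text \<open>Agents bid sincerely, so the bids are the utilities. The sum is meant for mechanisms
  with finitely many outcomes, such as \<open>like\<close>.\<close>

definition expected_utility :: "mechanism \<Rightarrow> alloc_instance \<Rightarrow> nat \<Rightarrow> real" where
  "expected_utility mech I i =
     (let P = mech (agents I) (util I) (arrival I)
      in \<Sum>\<pi>\<in>set_pmf P. pmf P \<pi> * of_rat (alloc_utility I i \<pi>))"

section \<open>Deterministic polynomial time\<close>

text \<open>Deterministic multi-tape Turing machines with two-way infinite tapes. A machine has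
  finitely many running states \<open>Run q\<close> with \<open>q < states\<close>, and its tape alphabet consists of
  the blank, the (finite) input alphabet and \<open>works\<close> many further symbols.\<close>

datatype 'a cell = Blank | Input 'a | Work nat

datatype move = MoveLeft | Stay | MoveRight

datatype control = Run nat | Accept | Reject

record 'a tm =
  tapes :: nat
  states :: nat
  works :: nat
  delta :: "nat \<Rightarrow> 'a cell list \<Rightarrow> control \<times> ('a cell \<times> move) list"

definition tape_symbols :: "'a tm \<Rightarrow> 'a cell set" where
  "tape_symbols M = {Blank} \<union> range Input \<union> Work ` {..<works M}"

definition wf_tm :: "'a tm \<Rightarrow> bool" where
  "wf_tm M \<longleftrightarrow> tapes M > 0 \<and> states M > 0 \<and>
     (\<forall>q<states M. \<forall>xs. length xs = tapes M \<and> set xs \<subseteq> tape_symbols M \<longrightarrow>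
        (case delta M q xs of (c, acts) \<Rightarrow>
           c \<in> {Accept, Reject} \<union> Run ` {..<states M} \<and>
           length acts = tapes M \<and> fst ` set acts \<subseteq> tape_symbols M))"

text \<open>A tape is its content together with the head position.\<close>

type_synonym 'a tape = "(int \<Rightarrow> 'a cell) \<times> int"

definition read :: "'a tape \<Rightarrow> 'a cell" where
  "read T = fst T (snd T)"

fun offset :: "move \<Rightarrow> int" where
  "offset MoveLeft = -1"
| "offset Stay = 0"
| "offset MoveRight = 1"

definition act :: "'a cell \<times> move \<Rightarrow> 'a tape \<Rightarrow> 'a tape" where
  "act a T = ((fst T)(snd T := fst a), snd T + offset (snd a))"

type_synonym 'a config = "control \<times> 'a tape list"

fun step :: "'a tm \<Rightarrow> 'a config \<Rightarrow> 'a config" where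
  "step M (Run q, Ts) =
     (case delta M q (map read Ts) of (c, acts) \<Rightarrow> (c, map2 act acts Ts))"
| "step M (Accept, Ts) = (Accept, Ts)"
| "step M (Reject, Ts) = (Reject, Ts)"

definition input_tape :: "'a list \<Rightarrow> 'a tape" where
  "input_tape w = (\<lambda>z. if 0 \<le> z \<and> z < int (length w) then Input (w ! nat z) else Blank, 0)"

definition blank_tape :: "'a tape" where
  "blank_tape = (\<lambda>_. Blank, 0)"

definition init :: "'a tm \<Rightarrow> 'a list \<Rightarrow> 'a config" where
  "init M w = (Run 0, input_tape w # replicate (tapes M - 1) blank_tape)"

definition decides_in_time :: "'a tm \<Rightarrow> 'a list set \<Rightarrow> (nat \<Rightarrow> nat) \<Rightarrow> bool" where
  "decides_in_time M L f \<longleftrightarrow>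
     (\<forall>w. \<exists>t\<le>f (length w).
        fst ((step M ^^ t) (init M w)) = (if w \<in> L then Accept else Reject))"

definition in_P :: "'a::finite list set \<Rightarrow> bool" where
  "in_P L \<longleftrightarrow> (\<exists>(M :: 'a tm) (p :: nat poly). wf_tm M \<and> decides_in_time M L (poly p))"

section \<open>The decision problem as a language\<close>

datatype letter = Zero | One | Mark | Minus | Slash | Comma | Semicolon | Hash

instance letter :: finite
proof
  have "(UNIV :: letter set) \<subseteq> {Zero, One, Mark, Minus, Slash, Comma, Semicolon, Hash}"
    by (auto intro: letter.exhaust)
  then show "finite (UNIV :: letter set)"
    by (rule finite_subset) simp
qed

text \<open>Numbers are written in binary, most significant bit first. Leading zeros and fractions
  that are not in lowest terms are admitted.\<close>

definition encodes_nat :: "letter list \<Rightarrow> nat \<Rightarrow> bool" where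
  "encodes_nat w n \<longleftrightarrow> (\<exists>bs. bs \<noteq> [] \<and> w = map (\<lambda>b. if b then One else Zero) bs \<and>
     n = horner_sum of_bool 2 (rev bs))"

definition encodes_frac :: "letter list \<Rightarrow> rat \<Rightarrow> bool" where
  "encodes_frac w r \<longleftrightarrow> (\<exists>u v p q. encodes_nat u p \<and> encodes_nat v q \<and> q > 0 \<and>
     w = u @ [Slash] @ v \<and> r = of_nat p / of_nat q)"

definition encodes_rat :: "letter list \<Rightarrow> rat \<Rightarrow> bool" where
  "encodes_rat w r \<longleftrightarrow> encodes_frac w r \<or> (\<exists>v. w = Minus # v \<and> encodes_frac v (- r))"

definition unary :: "nat \<Rightarrow> letter list" where
  "unary n = replicate n Mark"

definition terminated :: "letter \<Rightarrow> letter list list \<Rightarrow> letter list" where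
  "terminated x ws = concat (map (\<lambda>w. w @ [x]) ws)"

text \<open>A word lists the number of agents, the distinguished agent, the arrival order, the
  utilities item by item, and the threshold. The number of agents and the indices of agents
  and items are unary: they count or point into lists that form part of the instance, so this
  is polynomially equivalent to writing them in binary.\<close>

definition encodes :: "letter list \<Rightarrow> alloc_instance \<Rightarrow> nat \<Rightarrow> rat \<Rightarrow> bool" where
  "encodes w I i t \<longleftrightarrow> (\<exists>wss v.
     list_all2 (list_all2 encodes_frac) wss
       (map (\<lambda>k. map (\<lambda>j. util I j k) [0..<agents I]) [0..<items I]) \<and>
     encodes_rat v t \<and>
     w = unary (agents I) @ [Hash] @ unary i @ [Hash] @
         terminated Comma (map unary (arrival I)) @ [Hash] @
         terminated Semicolon (map (terminated Comma) wss) @ [Hash] @ v)"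

definition necessary_utility :: "mechanism \<Rightarrow> letter list set" where
  "necessary_utility mech =
     {w. \<exists>I i t. valid_instance I \<and> i < agents I \<and> encodes w I i t \<and>
         expected_utility mech I i \<ge> of_rat t}"

end

(* Agent i receives an item with probability 1/b, where b is the number of agents bidding for it, so
   its expected utility is the sum of u_ik / b_k over all items k, whatever the arrival order. The
   numerator and the denominator of this sum grow by only O(|row|) bits per item, hence exact
   binary arithmetic takes polynomial time.

   Turing machines are reached through structured programs on finitely many stacks, one per tape.
   State transformers computed by such programs in polynomial time are closed under composition,
   case distinction and loops with a polynomially bounded, decreasing potential that dominates
   the size of the state; the decision procedure is assembled from these closure properties. *)

theory Submission
  imports Defs "HOL-Library.While_Combinator"
begin

section \<open>Stack programs on Turing machines\<close>

text \<open>Polynomial time is not preserved by iteration: a body that doubles a register is cheap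
  once and exponential when repeated, so a bound on the number of rounds says nothing without a
  bound on growth. Hence every operation comes with a statement on the size of its result. These
  bounds are proved for arbitrary states, malformed words included, so that time and correctness
  never share an invariant; the price is that each operation is total and each loop body makes
  progress on any input. Fractions are never reduced, so neither division nor gcd has to be
  programmed. The one danger is a zero denominator, which an item without bidders would produce; a
  share is added only if the utility of the agent is positive, and then the agent itself bids. In
  the correctness proof, recognising a word is separated from evaluating it: soundness only recovers
  how an accepted word splits, and the value follows from the run of the program on the split
  word.\<close>

datatype ('r, 'a) cmd =
    Act 'r "'a option \<Rightarrow> 'a option \<times> move"
  | Seq "('r, 'a) cmd" "('r, 'a) cmd"
  | Branch 'r "'a option \<Rightarrow> ('r, 'a) cmd"
  | While 'r "'a option \<Rightarrow> bool" "('r, 'a) cmd"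

fun cell :: "'a option \<Rightarrow> 'a cell" where
  "cell None = Blank"
| "cell (Some a) = Input a"

fun uncell :: "'a cell \<Rightarrow> 'a option" where
  "uncell (Input a) = Some a"
| "uncell _ = None"

lemma uncell_cell [simp]: "uncell (cell x) = x"
  by (cases x) auto

text \<open>A machine step writes on every tape, so the tapes that a command does not address get
  back the symbol just read.\<close>

definition idle :: "('r \<Rightarrow> 'a option) \<Rightarrow> 'r \<Rightarrow> 'a option \<times> move" where
  "idle h = (\<lambda>r. (h r, Stay))"

text \<open>The control of a running program is the list of commands that remain to be executed;
  only finitely many such lists are reachable, so they can serve as machine states.\<close>

fun trans :: "('r, 'a) cmd list \<Rightarrow> ('r \<Rightarrow> 'a option) \<Rightarrow>
    ('r, 'a) cmd list \<times> ('r \<Rightarrow> 'a option \<times> move)" where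
  "trans [] h = ([], idle h)"
| "trans (Act r f # K) h = (K, (idle h)(r := f (h r)))"
| "trans (Seq c d # K) h = (c # d # K, idle h)"
| "trans (Branch r f # K) h = (f (h r) # K, idle h)"
| "trans (While r b c # K) h = (if b (h r) then c # While r b c # K else K, idle h)"

text \<open>The control lists met while the command is being executed in front of \<open>K\<close>,
  without \<open>K\<close> itself. A loop is put back as a whole behind its body, so unrolling
  creates no new lists and the set stays finite.\<close>

primrec conts :: "('r, 'a) cmd \<Rightarrow> ('r, 'a) cmd list \<Rightarrow> ('r, 'a) cmd list set" where
  "conts (Act r f) = (\<lambda>K. {Act r f # K})"
| "conts (Seq c d) = (\<lambda>K. insert (Seq c d # K) (conts c (d # K) \<union> conts d K))"
| "conts (Branch r f) = (\<lambda>K. insert (Branch r f # K) (\<Union>x. conts (f x) K))"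
| "conts (While r b c) = (\<lambda>K. insert (While r b c # K) (conts c (While r b c # K)))"

lemma conts_start [simp]: "c # K \<in> conts c K"
  by (cases c) auto

lemma finite_conts: "finite (conts c K)" for c :: "('r, 'a::finite) cmd"
  by (induction c arbitrary: K) auto

lemma trans_conts: "k \<in> conts c K \<Longrightarrow> fst (trans k h) \<in> insert K (conts c K)"
proof (induction c arbitrary: k K)
  case (Act r f)
  then show ?case by auto
next
  case (Seq c d)
  then show ?case by fastforce
next
  case (Branch r f)
  from Branch.prems consider "k = Branch r f # K" | x where "k \<in> conts (f x) K" by auto
  then show ?case
  proof cases
    case 1
    then have "fst (trans k h) = f (h r) # K" by simp
    then show ?thesis using 1 conts_start[of "f (h r)" K] by (simp; blast)
  next
    case 2
    then show ?thesis using Branch.IH[OF rangeI 2] by auto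
  qed
next
  case (While r b c)
  from While.prems consider "k = While r b c # K" | "k \<in> conts c (While r b c # K)" by auto
  then show ?case
  proof cases
    case 1
    then show ?thesis by auto
  next
    case 2
    then show ?thesis using While.IH[OF 2] by auto
  qed
qed

text \<open>The empty control list is still a running state: one further step inspects tape
  \<open>e\<close> and accepts iff it shows a blank. All other states follow
  \<open>trans\<close>.\<close>

definition machine :: "'r list \<Rightarrow> 'r \<Rightarrow> ('r, 'a) cmd list list \<Rightarrow> 'a tm" where
  "machine rs e qs = \<lparr>tapes = length rs, states = length qs, works = 0,
     delta = (\<lambda>q xs. let h = (\<lambda>r. uncell (the (map_of (zip rs xs) r))) in
       if qs ! q = []
       then (if h e = None then Accept else Reject, map (\<lambda>x. (x, Stay)) xs)
       else (case trans (qs ! q) h of (K, a) \<Rightarrow>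
         (Run (SOME p. p < length qs \<and> qs ! p = K),
          map (\<lambda>r. map_prod cell id (a r)) rs)))\<rparr>"

text \<open>The same machine with control lists in place of state numbers and tapes indexed by
  registers, which keeps the reasoning about programs free of list positions.\<close>

fun astep :: "('r, 'a) cmd list \<times> ('r \<Rightarrow> 'a tape) \<Rightarrow>
    ('r, 'a) cmd list \<times> ('r \<Rightarrow> 'a tape)" where
  "astep ([], \<tau>) = ([], \<tau>)"
| "astep (c # K, \<tau>) = (case trans (c # K) (\<lambda>r. uncell (read (\<tau> r))) of
     (K', a) \<Rightarrow> (K', \<lambda>r. act (map_prod cell id (a r)) (\<tau> r)))"

section \<open>Simulation of control lists by the compiled machine\<close>

locale control =
  fixes rs :: "'r list" and qs :: "('r, 'a) cmd list list"
  assumes rs: "set rs = UNIV" "distinct rs"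
    and closed: "\<And>k h. k \<in> set qs \<Longrightarrow> fst (trans k h) \<in> set qs"
begin

lemma index:
  assumes "K \<in> set qs"
  shows "(SOME p. p < length qs \<and> qs ! p = K) < length qs"
    and "qs ! (SOME p. p < length qs \<and> qs ! p = K) = K"
  using someI_ex[of "\<lambda>p. p < length qs \<and> qs ! p = K"] assms
  by (auto simp: in_set_conv_nth)

lemma wf_machine:
  assumes "rs \<noteq> []" "qs \<noteq> []"
  shows "wf_tm (machine rs e qs)"
proof -
  have cell: "cell y \<in> tape_symbols (machine rs e qs)" for y
    by (cases y) (auto simp: tape_symbols_def)
  have "case delta (machine rs e qs) q xs of (c, acts) \<Rightarrow>
           c \<in> {Accept, Reject} \<union> Run ` {..<length qs} \<and>
           length acts = length rs \<and> fst ` set acts \<subseteq> tape_symbols (machine rs e qs)"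
    if q: "q < length qs" and len: "length xs = length rs"
      and xs: "set xs \<subseteq> tape_symbols (machine rs e qs)" for q xs
  proof -
    define h where "h = (\<lambda>r. uncell (the (map_of (zip rs xs) r)))"
    obtain K a where t: "trans (qs ! q) h = (K, a)" by fastforce
    have "K \<in> set qs" using closed[of "qs ! q" h] t q by simp
    then have "(SOME p. p < length qs \<and> qs ! p = K) < length qs" by (rule index)
    then show ?thesis
      using xs len cell by (auto simp: machine_def t h_def[symmetric] Let_def)
  qed
  then show ?thesis
    using assms unfolding wf_tm_def by (simp add: machine_def)
qed

lemma step_machine:
  assumes "q < length qs" "qs ! q \<noteq> []" "astep (qs ! q, \<tau>) = (K, \<tau>')"
  shows "\<exists>p < length qs. qs ! p = K \<and>
    step (machine rs e qs) (Run q, map \<tau> rs) = (Run p, map \<tau>' rs)"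
proof -
  define h where "h = (\<lambda>r. uncell (read (\<tau> r)))"
  have h: "(\<lambda>r. uncell (the (map_of (zip rs (map (read \<circ> \<tau>) rs)) r))) = h"
    using rs by (auto simp: fun_eq_iff h_def map_of_zip_map)
  obtain K' a where t: "trans (qs ! q) h = (K', a)" by fastforce
  have K: "K' = K" "\<tau>' = (\<lambda>r. act (map_prod cell id (a r)) (\<tau> r))"
    using assms(2,3) t by (cases "qs ! q"; simp add: h_def)+
  have "K \<in> set qs" using closed[of "qs ! q" h] t K assms(1) by simp
  note p = index[OF this]
  have m: "map2 act (map f xs) (map g xs) = map (\<lambda>r. act (f r) (g r)) xs" for f g and xs :: "'r list"
    by (induction xs) auto
  show ?thesis
    by (rule exI[of _ "SOME p. p < length qs \<and> qs ! p = K"])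
      (use p assms(2) in \<open>simp add: machine_def h t K m\<close>)
qed

text \<open>\<open>astep\<close> idles at the empty list whereas the machine goes on to halt, so the
  two are compared up to the first moment at which the list is empty. This is why only some
  \<open>t' \<le> t\<close> is obtained.\<close>

lemma steps_machine:
  assumes "q < length qs" "(astep ^^ t) (qs ! q, \<tau>) = ([], \<tau>')"
  shows "\<exists>t' \<le> t. \<exists>p < length qs. qs ! p = [] \<and>
    (step (machine rs e qs) ^^ t') (Run q, map \<tau> rs) = (Run p, map \<tau>' rs)"
  using assms
proof (induction t arbitrary: q \<tau>)
  case 0
  then show ?case by auto
next
  case (Suc t)
  show ?case
  proof (cases "qs ! q = []")
    case True
    have "(astep ^^ n) ([], \<tau>) = ([], \<tau>)" for n
      by (induction n) auto
    with Suc.prems True have "\<tau>' = \<tau>" by (metis prod.inject)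
    then show ?thesis using Suc.prems(1) True by (intro exI[of _ 0]) auto
  next
    case False
    obtain K \<sigma> where K: "astep (qs ! q, \<tau>) = (K, \<sigma>)" by fastforce
    from step_machine[OF Suc.prems(1) False K] obtain p where p: "p < length qs" "qs ! p = K"
      "step (machine rs e qs) (Run q, map \<tau> rs) = (Run p, map \<sigma> rs)" by blast
    have "(astep ^^ t) (qs ! p, \<sigma>) = ([], \<tau>')"
      using Suc.prems(2) K p(2) by (simp add: funpow_swap1)
    from Suc.IH[OF p(1) this] obtain t' p' where "t' \<le> t" "p' < length qs" "qs ! p' = []"
      "(step (machine rs e qs) ^^ t') (Run p, map \<sigma> rs) = (Run p', map \<tau>' rs)" by blast
    then show ?thesis
      using p(3) by (intro exI[of _ "Suc t'"]) (auto simp: funpow_swap1)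
  qed
qed

lemma halt_machine:
  assumes "qs ! p = []"
  shows "fst (step (machine rs e qs) (Run p, map \<tau> rs)) =
    (if uncell (read (\<tau> e)) = None then Accept else Reject)"
  using assms rs by (simp add: machine_def Let_def map_of_zip_map)

end

text \<open>A stack occupies the cells from the head rightwards, its top being under the head. So the
  input tape holds the input word as a stack and popping never needs a test for emptiness.\<close>

definition stack_tape :: "'a tape \<Rightarrow> 'a list \<Rightarrow> bool" where
  "stack_tape T xs \<longleftrightarrow> (\<forall>z. fst T z =
     (if 0 \<le> z - snd T \<and> z - snd T < int (length xs) then Input (xs ! nat (z - snd T)) else Blank))"

definition peek :: "'a list \<Rightarrow> 'a option" where
  "peek xs = (case xs of [] \<Rightarrow> None | x # _ \<Rightarrow> Some x)"

lemma peek_simps [simp]: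
  "peek [] = None" "peek (x # xs) = Some x" "peek xs = None \<longleftrightarrow> xs = []"
  by (auto simp: peek_def split: list.splits)

lemma stack_read: "stack_tape T xs \<Longrightarrow> read T = cell (peek xs)"
  by (cases xs) (auto simp: stack_tape_def read_def)

lemma act_stay: "stack_tape T xs \<Longrightarrow> act (cell (peek xs), Stay) T = T"
  using stack_read[of T xs] by (auto simp: act_def read_def prod_eq_iff)

lemma act_pop:
  assumes "stack_tape T xs"
  shows "stack_tape (act (Blank, MoveRight) T) (tl xs)"
proof (cases xs)
  case Nil
  then show ?thesis using assms by (auto simp: stack_tape_def act_def)
next
  case (Cons x ys)
  have "nat (z - snd T) = Suc (nat (z - snd T - 1))" if "z \<ge> snd T + 1" for z
    using that by linarith
  then show ?thesis using assms Cons
    by (auto simp: stack_tape_def act_def algebra_simps)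
qed

text \<open>An action writes before it moves, so a push needs two of them: one moves left and leaves
  the old top as it is, the other writes on the free cell.\<close>

lemma act_push:
  assumes "stack_tape T xs"
  shows "stack_tape (act (Input a, Stay) (act (cell (peek xs), MoveLeft) T)) (a # xs)"
proof -
  have T: "(fst T)(snd T := cell (peek xs)) = fst T"
    using stack_read[OF assms] by (auto simp: read_def)
  have "nat (z - snd T + 1) = Suc (nat (z - snd T))" if "z \<ge> snd T" for z
    using that by linarith
  then show ?thesis using assms
    by (auto simp: stack_tape_def act_def T algebra_simps)
qed

text \<open>Quantifying over the continuation \<open>K\<close> makes runs composable, in particular
  the run of a loop body in front of its loop. Tapes are fixed only up to the stacks that they
  represent, so head positions may drift.\<close>

definition runs :: "('r, 'a) cmd \<Rightarrow> ('r \<Rightarrow> 'a list) \<Rightarrow> nat \<Rightarrow> ('r \<Rightarrow> 'a list) \<Rightarrow> bool" where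
  "runs c s t s' \<longleftrightarrow> (\<forall>\<tau> K. (\<forall>r. stack_tape (\<tau> r) (s r)) \<longrightarrow>
     (\<exists>t' \<le> t. \<exists>\<tau>'. (\<forall>r. stack_tape (\<tau>' r) (s' r)) \<and> (astep ^^ t') (c # K, \<tau>) = (K, \<tau>')))"

lemma runs_mono: "runs c s t s' \<Longrightarrow> t \<le> u \<Longrightarrow> runs c s u s'"
  unfolding runs_def by (meson order_trans)

lemma astep_idle:
  assumes "\<forall>r. stack_tape (\<tau> r) (s r)"
  shows "act (map_prod cell id (idle (\<lambda>r. uncell (read (\<tau> r))) r)) (\<tau> r) = \<tau> r"
  using assms stack_read[of "\<tau> r" "s r"] by (simp add: idle_def act_stay)

lemma runs_pop: "runs (Act r (\<lambda>_. (None, MoveRight))) s 1 (s(r := tl (s r)))"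
  unfolding runs_def
proof (intro allI impI)
  fix \<tau> and K
  assume \<tau>: "\<forall>r. stack_tape (\<tau> r) (s r)"
  have "\<forall>q. stack_tape ((\<tau>(r := act (Blank, MoveRight) (\<tau> r))) q) ((s(r := tl (s r))) q)"
    using \<tau> act_pop[of "\<tau> r" "s r"] by simp
  moreover have "(astep ^^ 1) (Act r (\<lambda>_. (None, MoveRight)) # K, \<tau>) =
      (K, \<tau>(r := act (Blank, MoveRight) (\<tau> r)))"
    using astep_idle[OF \<tau>] by (auto simp: fun_eq_iff)
  ultimately show "\<exists>t' \<le> 1. \<exists>\<tau>'. (\<forall>q. stack_tape (\<tau>' q) ((s(r := tl (s r))) q)) \<and>
      (astep ^^ t') (Act r (\<lambda>_. (None, MoveRight)) # K, \<tau>) = (K, \<tau>')"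
    by blast
qed

lemma runs_push:
  "runs (Seq (Act r (\<lambda>x. (x, MoveLeft))) (Act r (\<lambda>_. (Some a, Stay)))) s 3 (s(r := a # s r))"
  unfolding runs_def
proof (intro allI impI)
  let ?c = "Act r (\<lambda>x. (x, MoveLeft))" and ?d = "Act r (\<lambda>_. (Some a, Stay))"
  fix \<tau> and K
  assume \<tau>: "\<forall>r. stack_tape (\<tau> r) (s r)"
  let ?\<sigma> = "\<tau>(r := act (cell (peek (s r)), MoveLeft) (\<tau> r))"
  let ?\<rho> = "\<tau>(r := act (Input a, Stay) (act (cell (peek (s r)), MoveLeft) (\<tau> r)))"
  have 1: "astep (Seq ?c ?d # K, \<tau>) = (?c # ?d # K, \<tau>)"
    using astep_idle[OF \<tau>] by auto
  have 2: "astep (?c # ?d # K, \<tau>) = (?d # K, ?\<sigma>)"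
    using astep_idle[OF \<tau>] stack_read[of "\<tau> r" "s r"] \<tau> by (auto simp: fun_eq_iff)
  have 3: "astep (?d # K, ?\<sigma>) = (K, ?\<rho>)"
    using astep_idle[OF \<tau>] by (auto simp: fun_eq_iff idle_def)
  have "(astep ^^ 3) (Seq ?c ?d # K, \<tau>) = (K, ?\<rho>)"
    using 1 2 3 by (simp add: numeral_3_eq_3)
  moreover have "\<forall>q. stack_tape (?\<rho> q) ((s(r := a # s r)) q)"
    using \<tau> act_push[of "\<tau> r" "s r" a] by simp
  ultimately show "\<exists>t' \<le> 3. \<exists>\<tau>'. (\<forall>q. stack_tape (\<tau>' q) ((s(r := a # s r)) q)) \<and>
      (astep ^^ t') (Seq ?c ?d # K, \<tau>) = (K, \<tau>')"
    by blast
qed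

text \<open>Common pattern of the control commands: unfolding one costs a single step and leaves all
  tapes unchanged.\<close>

lemma runs_step:
  assumes "\<And>\<tau> K. \<forall>r. stack_tape (\<tau> r) (s r) \<Longrightarrow> astep (c # K, \<tau>) = (d # K, \<tau>)"
    and "runs d s t s'"
  shows "runs c s (t + 1) s'"
  unfolding runs_def
proof (intro allI impI)
  fix \<tau> and K
  assume \<tau>: "\<forall>r. stack_tape (\<tau> r) (s r)"
  with assms(2) obtain t' \<tau>' where *: "t' \<le> t" "\<forall>r. stack_tape (\<tau>' r) (s' r)"
    "(astep ^^ t') (d # K, \<tau>) = (K, \<tau>')" unfolding runs_def by meson
  have "(astep ^^ Suc t') (c # K, \<tau>) = (K, \<tau>')"
    using *(3) assms(1)[OF \<tau>] by (simp add: funpow_swap1)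
  then show "\<exists>t' \<le> t + 1. \<exists>\<tau>'. (\<forall>r. stack_tape (\<tau>' r) (s' r)) \<and> (astep ^^ t') (c # K, \<tau>) = (K, \<tau>')"
    using *(1,2) by (intro exI[of _ "Suc t'"]) auto
qed

lemma runs_step2:
  assumes "\<And>\<tau> K. \<forall>r. stack_tape (\<tau> r) (s r) \<Longrightarrow> astep (c # K, \<tau>) = (d # e # K, \<tau>)"
    and "runs d s t s'" "runs e s' u s''"
  shows "runs c s (t + u + 1) s''"
  unfolding runs_def
proof (intro allI impI)
  fix \<tau> and K
  assume \<tau>: "\<forall>r. stack_tape (\<tau> r) (s r)"
  with assms(2) obtain t' \<tau>' where 1: "t' \<le> t" "\<forall>r. stack_tape (\<tau>' r) (s' r)"
    "(astep ^^ t') (d # e # K, \<tau>) = (e # K, \<tau>')" unfolding runs_def by meson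
  with assms(3) obtain u' \<tau>'' where 2: "u' \<le> u" "\<forall>r. stack_tape (\<tau>'' r) (s'' r)"
    "(astep ^^ u') (e # K, \<tau>') = (K, \<tau>'')" unfolding runs_def by meson
  have "(astep ^^ Suc (u' + t')) (c # K, \<tau>) = (K, \<tau>'')"
    using 1(3) 2(3) assms(1)[OF \<tau>]
    by (simp only: funpow_Suc_right o_apply funpow_add)
  then show "\<exists>t' \<le> t + u + 1. \<exists>\<tau>'. (\<forall>r. stack_tape (\<tau>' r) (s'' r)) \<and>
      (astep ^^ t') (c # K, \<tau>) = (K, \<tau>')"
    using 1(1) 2(1,2) by (intro exI[of _ "Suc (u' + t')"]) auto
qed

lemma runs_seq: "runs c s t s' \<Longrightarrow> runs d s' u s'' \<Longrightarrow> runs (Seq c d) s (t + u + 1) s''"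
  by (rule runs_step2) (use astep_idle in \<open>auto simp: fun_eq_iff\<close>)

lemma runs_branch: "runs (f (peek (s r))) s t s' \<Longrightarrow> runs (Branch r f) s (t + 1) s'"
proof (rule runs_step)
  fix \<tau> and K
  assume \<tau>: "\<forall>r. stack_tape (\<tau> r) (s r)"
  then have "uncell (read (\<tau> r)) = peek (s r)"
    using stack_read[of "\<tau> r" "s r"] by simp
  then show "astep (Branch r f # K, \<tau>) = (f (peek (s r)) # K, \<tau>)"
    using astep_idle[OF \<tau>] by (simp add: fun_eq_iff)
qed

lemma runs_while_true:
  assumes "b (peek (s r))" "runs c s t s'" "runs (While r b c) s' u s''"
  shows "runs (While r b c) s (t + u + 1) s''"
proof (rule runs_step2[OF _ assms(2,3)])
  fix \<tau> and K
  assume \<tau>: "\<forall>r. stack_tape (\<tau> r) (s r)"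
  then have "uncell (read (\<tau> r)) = peek (s r)"
    using stack_read[of "\<tau> r" "s r"] by simp
  then show "astep (While r b c # K, \<tau>) = (c # While r b c # K, \<tau>)"
    using assms(1) astep_idle[OF \<tau>] by (simp add: fun_eq_iff)
qed

lemma runs_while_false:
  assumes "\<not> b (peek (s r))"
  shows "runs (While r b c) s 1 s"
  unfolding runs_def
proof (intro allI impI)
  fix \<tau> and K
  assume \<tau>: "\<forall>r. stack_tape (\<tau> r) (s r)"
  then have "uncell (read (\<tau> r)) = peek (s r)"
    using stack_read[of "\<tau> r" "s r"] by simp
  then have "(astep ^^ 1) (While r b c # K, \<tau>) = (K, \<tau>)"
    using assms astep_idle[OF \<tau>] by (simp add: fun_eq_iff)
  then show "\<exists>t' \<le> 1. \<exists>\<tau>'. (\<forall>r. stack_tape (\<tau>' r) (s r)) \<and>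
      (astep ^^ t') (While r b c # K, \<tau>) = (K, \<tau>')"
    using \<tau> by blast
qed

section \<open>State transformers computable in polynomial time\<close>

text \<open>Coefficients are natural numbers, so polynomials are monotone. This permits replacing
  the size of an intermediate state by a bound on it.\<close>

lemma poly_nat_mono: "x \<le> y \<Longrightarrow> poly p x \<le> poly p y" for x y :: nat
  by (induction p) (auto intro!: add_mono mult_mono)

definition ssize :: "('r::finite \<Rightarrow> 'a list) \<Rightarrow> nat" where
  "ssize s = (\<Sum>r\<in>UNIV. length (s r))"

lemma ssize_upd: "ssize (s(r := xs)) + length (s r) = ssize s + length xs"
proof -
  have "(\<Sum>q\<in>UNIV - {r}. length ((s(r := xs)) q)) = (\<Sum>q\<in>UNIV - {r}. length (s q))"
    by (rule sum.cong) auto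
  then show ?thesis
    unfolding ssize_def by (simp add: sum.remove[of UNIV r])
qed

lemma length_le_ssize: "length (s r) \<le> ssize s"
  unfolding ssize_def by (rule member_le_sum) auto

text \<open>The size of the result is bounded along with the time, because the next program runs on
  that result.\<close>

definition ptime :: "(('r::finite \<Rightarrow> 'a list) \<Rightarrow> 'r \<Rightarrow> 'a list) \<Rightarrow> bool" where
  "ptime F \<longleftrightarrow> (\<exists>c p. \<forall>s. runs c s (poly p (ssize s)) (F s) \<and> ssize (F s) \<le> poly p (ssize s))"

lemma ptimeI:
  assumes "\<And>s. runs c s (poly p (ssize s)) (F s)" "\<And>s. ssize (F s) \<le> poly q (ssize s)"
  shows "ptime F"
  unfolding ptime_def
proof (intro exI[of _ c] exI[of _ "p + q"] allI conjI)
  fix s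
  show "runs c s (poly (p + q) (ssize s)) (F s)"
    using assms(1) by (rule runs_mono) simp
  show "ssize (F s) \<le> poly (p + q) (ssize s)"
    using assms(2)[of s] by simp
qed

named_theorems ptime

definition pop :: "'r \<Rightarrow> ('r \<Rightarrow> 'a list) \<Rightarrow> 'r \<Rightarrow> 'a list" where
  "pop r s = s(r := tl (s r))"

definition push :: "'r \<Rightarrow> 'a \<Rightarrow> ('r \<Rightarrow> 'a list) \<Rightarrow> 'r \<Rightarrow> 'a list" where
  "push r a s = s(r := a # s r)"

definition branch :: "'r \<Rightarrow> ('a option \<Rightarrow> ('r \<Rightarrow> 'a list) \<Rightarrow> 'r \<Rightarrow> 'a list) \<Rightarrow>
    ('r \<Rightarrow> 'a list) \<Rightarrow> 'r \<Rightarrow> 'a list" where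
  "branch r G s = G (peek (s r)) s"

text \<open>\<open>while\<close> is total and its unfolding equation holds even for a diverging
  loop; termination becomes an issue only in the rules that bound time or perform induction.\<close>

definition loop :: "'r \<Rightarrow> ('a option \<Rightarrow> bool) \<Rightarrow> (('r \<Rightarrow> 'a list) \<Rightarrow> 'r \<Rightarrow> 'a list) \<Rightarrow>
    ('r \<Rightarrow> 'a list) \<Rightarrow> 'r \<Rightarrow> 'a list" where
  "loop r b F = while (\<lambda>s. b (peek (s r))) F"

lemma loop_unfold: "loop r b F s = (if b (peek (s r)) then loop r b F (F s) else s)"
  unfolding loop_def by (rule while_unfold)

lemma ptime_pop [ptime]: "ptime (pop r)"
proof (rule ptimeI[where p = 1 and q = "[:0, 1:]"])
  show "runs (Act r (\<lambda>_. (None, MoveRight))) s (poly 1 (ssize s)) (pop r s)" for s :: "'a \<Rightarrow> 'b list"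
    using runs_pop[of r s] by (simp add: pop_def)
  show "ssize (pop r s) \<le> poly [:0, 1:] (ssize s)" for s :: "'a \<Rightarrow> 'b list"
    using ssize_upd[of s r "tl (s r)"] by (simp add: pop_def)
qed

lemma ptime_push [ptime]: "ptime (push r a)"
proof (rule ptimeI[where p = "[:3:]" and q = "[:1, 1:]"])
  show "runs (Seq (Act r (\<lambda>x. (x, MoveLeft))) (Act r (\<lambda>_. (Some a, Stay)))) s
      (poly [:3:] (ssize s)) (push r a s)" for s
    using runs_push[of r a s] by (simp add: push_def)
  show "ssize (push r a s) \<le> poly [:1, 1:] (ssize s)" for s :: "'a \<Rightarrow> 'b list"
    using ssize_upd[of s r "a # s r"] by (simp add: push_def)
qed

lemma ptime_comp [ptime]:
  assumes "ptime G" "ptime F"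
  shows "ptime (G \<circ> F)"
proof -
  from assms obtain c p d q where
    F: "\<And>s. runs c s (poly p (ssize s)) (F s)" "\<And>s. ssize (F s) \<le> poly p (ssize s)" and
    G: "\<And>s. runs d s (poly q (ssize s)) (G s)" "\<And>s. ssize (G s) \<le> poly q (ssize s)"
    unfolding ptime_def by metis
  have G': "runs d (F s) (poly (q \<circ>\<^sub>p p) (ssize s)) (G (F s))"
       "ssize (G (F s)) \<le> poly (q \<circ>\<^sub>p p) (ssize s)" for s
    using runs_mono[OF G(1)[of "F s"]] G(2)[of "F s"] poly_nat_mono[OF F(2)[of s], of q]
    by (auto simp: poly_pcompose)
  show ?thesis
  proof (rule ptimeI)
    show "runs (Seq c d) s (poly (p + q \<circ>\<^sub>p p + 1) (ssize s)) ((G \<circ> F) s)" for s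
      using runs_seq[OF F(1)[of s] G'(1)[of s]] by simp
    show "ssize ((G \<circ> F) s) \<le> poly (q \<circ>\<^sub>p p) (ssize s)" for s
      using G'(2) by simp
  qed
qed

lemma ptime_id [ptime]: "ptime (\<lambda>s. s)"
proof (rule ptimeI)
  fix s :: "'a \<Rightarrow> 'b list"
  \<comment> \<open>A loop whose test always fails serves as the empty program.\<close>
  show "runs (While undefined (\<lambda>_. False) undefined) s (poly 1 (ssize s)) s"
    using runs_while_false[of "\<lambda>_. False" s undefined undefined] by simp
  show "ssize s \<le> poly [:0, 1:] (ssize s)"
    by simp
qed

lemma ptime_branch [ptime]:
  fixes G :: "'a::finite option \<Rightarrow> ('r::finite \<Rightarrow> 'a list) \<Rightarrow> 'r \<Rightarrow> 'a list"
  assumes "\<And>x. ptime (G x)"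
  shows "ptime (branch r G)"
proof -
  from assms obtain c p where
    G: "\<And>x s. runs (c x) s (poly (p x) (ssize s)) (G x s)" "\<And>x s. ssize (G x s) \<le> poly (p x) (ssize s)"
    unfolding ptime_def by metis
  \<comment> \<open>The alphabet is finite, so one polynomial dominates the bounds of all
    branches.\<close>
  define q where "q = (\<Sum>x\<in>UNIV. p x)"
  have q: "poly (p x) n \<le> poly q n" for x n
    unfolding q_def poly_sum by (rule member_le_sum) auto
  show ?thesis
  proof (rule ptimeI)
    fix s
    have "runs (c (peek (s r))) s (poly q (ssize s)) (G (peek (s r)) s)"
      by (rule runs_mono[OF G(1) q])
    then show "runs (Branch r c) s (poly (q + 1) (ssize s)) (branch r G s)"
      unfolding branch_def using runs_branch by fastforce
    show "ssize (branch r G s) \<le> poly q (ssize s)"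
      unfolding branch_def using G(2) q order_trans by blast
  qed
qed

section \<open>Loops with a decreasing potential\<close>

definition polybd :: "(('r::finite \<Rightarrow> 'a list) \<Rightarrow> nat) \<Rightarrow> bool" where
  "polybd \<phi> \<longleftrightarrow> (\<exists>q. \<forall>s. \<phi> s \<le> poly q (ssize s))"

lemma polybd_const [intro!]: "polybd (\<lambda>_. k)"
  unfolding polybd_def by (rule exI[of _ "[:k:]"]) simp

lemma polybd_length [intro!]: "polybd (\<lambda>s. length (s r))"
  unfolding polybd_def by (rule exI[of _ "[:0, 1:]"]) (simp add: length_le_ssize)

lemma polybd_ssize [intro!]: "polybd ssize"
  unfolding polybd_def by (rule exI[of _ "[:0, 1:]"]) simp

lemma polybd_add [intro!]:
  assumes "polybd f" "polybd g"
  shows "polybd (\<lambda>s. f s + g s)"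
proof -
  from assms obtain p q where "\<forall>s. f s \<le> poly p (ssize s)" "\<forall>s. g s \<le> poly q (ssize s)"
    unfolding polybd_def by blast
  then show ?thesis
    unfolding polybd_def by (intro exI[of _ "p + q"]) (simp add: add_mono)
qed

lemma polybd_mult [intro!]:
  assumes "polybd f" "polybd g"
  shows "polybd (\<lambda>s. f s * g s)"
proof -
  from assms obtain p q where "\<forall>s. f s \<le> poly p (ssize s)" "\<forall>s. g s \<le> poly q (ssize s)"
    unfolding polybd_def by blast
  then show ?thesis
    unfolding polybd_def by (intro exI[of _ "p * q"]) (simp add: mult_mono)
qed

text \<open>The potential bounds the rounds that are left and, at every moment, the size of the
  state. Each round therefore costs at most the bound of the body at the initial potential, however
  the size evolves.\<close>

lemma ptime_loop_potential:
  assumes "ptime F" "polybd \<phi>"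
    and size: "\<And>s. ssize s \<le> \<phi> s"
    and less: "\<And>s. b (peek (s r)) \<Longrightarrow> \<phi> (F s) < \<phi> s"
  shows "ptime (loop r b F)"
proof -
  from assms(1) obtain c p where
    F: "\<And>s. runs c s (poly p (ssize s)) (F s)" "\<And>s. ssize (F s) \<le> poly p (ssize s)"
    unfolding ptime_def by metis
  from assms(2) obtain q where q: "\<And>s. \<phi> s \<le> poly q (ssize s)"
    unfolding polybd_def by blast
  \<comment> \<open>\<open>N\<close> caps the potential and stays fixed while
    \<open>\<phi> s\<close> falls in the induction. Each round pays one extra step for its test, and
    the final summand 1 is the test that fails.\<close>
  have *: "runs (While r b c) s (\<phi> s * (poly p N + 1) + 1) (loop r b F s) \<and>
      ssize (loop r b F s) \<le> \<phi> s" if "\<phi> s \<le> N" for s N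
    using that
  proof (induction "\<phi> s" arbitrary: s rule: less_induct)
    case IH: less
    show ?case
    proof (cases "b (peek (s r))")
      case True
      note lt = less[of s, OF True]
      have W: "runs (While r b c) (F s) (\<phi> (F s) * (poly p N + 1) + 1) (loop r b F (F s))"
        "ssize (loop r b F (F s)) \<le> \<phi> (F s)"
        using IH.hyps[OF lt] lt IH.prems by auto
      have "poly p (ssize s) \<le> poly p N"
        using size[of s] IH.prems by (intro poly_nat_mono) simp
      moreover have "Suc (\<phi> (F s)) * (poly p N + 1) \<le> \<phi> s * (poly p N + 1)"
        using lt by (intro mult_right_mono) auto
      ultimately have "poly p (ssize s) + (\<phi> (F s) * (poly p N + 1) + 1) + 1 \<le> \<phi> s * (poly p N + 1) + 1"
        by simp
      then have "runs (While r b c) s (\<phi> s * (poly p N + 1) + 1) (loop r b F (F s))"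
        using runs_mono[OF runs_while_true[where b = b and r = r and s = s, OF True F(1) W(1)]] by blast
      then show ?thesis
        using True W(2) lt by (simp add: loop_unfold[of r b F s])
    next
      case False
      have "runs (While r b c) s (\<phi> s * (poly p N + 1) + 1) s"
        by (rule runs_mono[OF runs_while_false[where b = b and r = r and s = s, OF False]]) simp
      then show ?thesis
        using False size[of s] by (simp add: loop_unfold[of r b F s])
    qed
  qed
  show ?thesis
  proof (rule ptimeI)
    fix s
    have "\<phi> s * (poly p (\<phi> s) + 1) + 1 \<le> poly (q * (p \<circ>\<^sub>p q + 1) + 1) (ssize s)"
      using q[of s] poly_nat_mono[OF q[of s], of p] by (simp add: poly_pcompose add_mono mult_mono)
    then show "runs (While r b c) s (poly (q * (p \<circ>\<^sub>p q + 1) + 1) (ssize s)) (loop r b F s)"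
      using *[of s "\<phi> s"] runs_mono by blast
    show "ssize (loop r b F s) \<le> poly q (ssize s)"
      using *[of s "\<phi> s"] q[of s] by simp
  qed
qed

text \<open>At most \<open>length (s r)\<close> rounds remain and each adds at most
  \<open>g s\<close>, which never increases. The potential reserves this growth in advance; the 1
  added to \<open>g s\<close> makes it strictly decreasing.\<close>

lemma ptime_loop:
  assumes "ptime F" "polybd g"
    and "\<And>s. b (peek (s r)) \<Longrightarrow> length (F s r) < length (s r)"
    and "\<And>s. b (peek (s r)) \<Longrightarrow> ssize (F s) \<le> ssize s + g s"
    and "\<And>s. b (peek (s r)) \<Longrightarrow> g (F s) \<le> g s"
  shows "ptime (loop r b F)"
proof (rule ptime_loop_potential[where \<phi> = "\<lambda>s. ssize s + length (s r) * (g s + 1)"])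
  show "polybd (\<lambda>s. ssize s + length (s r) * (g s + 1))"
    using assms(2) by (intro polybd_add polybd_mult polybd_ssize polybd_length polybd_const)
  fix s assume b: "b (peek (s r))"
  note F = assms(3)[of s, OF b] assms(4)[of s, OF b] assms(5)[of s, OF b]
  have "length (F s r) * (g (F s) + 1) \<le> length (F s r) * (g s + 1)"
    using F by (intro mult_mono) auto
  moreover have "Suc (length (F s r)) * (g s + 1) \<le> length (s r) * (g s + 1)"
    using F by (intro mult_mono) auto
  ultimately show "ssize (F s) + length (F s r) * (g (F s) + 1) < ssize s + length (s r) * (g s + 1)"
    using F(2) unfolding mult_Suc by linarith
qed (use assms in auto)

section \<open>From stack programs to the class P\<close>

lemma in_P_ptime:
  fixes F :: "('r::finite \<Rightarrow> 'a::finite list) \<Rightarrow> 'r \<Rightarrow> 'a list"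
  assumes "ptime F"
  shows "in_P {w. F ((\<lambda>_. [])(x := w)) e = []}"
proof -
  from assms obtain c p where F: "\<And>s. runs c s (poly p (ssize s)) (F s)"
    unfolding ptime_def by metis
  obtain rs' where rs': "set rs' = UNIV - {x}" "distinct rs'"
    using finite_distinct_list[of "UNIV - {x}"] by auto
  obtain qs' where qs': "set qs' = insert [] (conts c [])"
    using finite_list[of "insert [] (conts c [])"] finite_conts[of c "[]"] by auto
  \<comment> \<open>The input lies on the first tape and the run starts in state 0, so
    \<open>x\<close> and \<open>[c]\<close> head the two lists. \<open>[c]\<close> occurs again in
    \<open>qs'\<close>, which is harmless: any index of a control list may represent it.\<close>
  define rs where "rs = x # rs'"
  define qs where "qs = [c] # qs'"
  have qs: "set qs = insert [] (conts c [])"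
    by (auto simp: qs_def qs')
  interpret control rs qs
  proof
    show "fst (trans k h) \<in> set qs" if "k \<in> set qs" for k h
      using that trans_conts[of k c "[]" h] by (auto simp: qs)
  qed (use rs' in \<open>auto simp: rs_def\<close>)
  let ?M = "machine rs e qs"
  have "\<exists>t \<le> poly (p + 1) (length w). fst ((step ?M ^^ t) (init ?M w)) =
      (if F ((\<lambda>_. [])(x := w)) e = [] then Accept else Reject)" for w
  proof -
    define s :: "'r \<Rightarrow> 'a list" where "s = (\<lambda>_. [])(x := w)"
    define \<tau> :: "'r \<Rightarrow> 'a tape" where "\<tau> = (\<lambda>_. blank_tape)(x := input_tape w)"
    have size: "ssize s = length w"
      using ssize_upd[of "\<lambda>_. []" x w] by (simp add: s_def ssize_def)
    have "init ?M w = (Run 0, map \<tau> rs)"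
    proof -
      have "map \<tau> rs' = replicate (length rs') blank_tape"
        using rs'(1) by (auto simp: \<tau>_def map_eq_conv simp flip: map_replicate_const)
      then show ?thesis
        by (simp add: init_def machine_def rs_def \<tau>_def)
    qed
    moreover have "\<forall>r. stack_tape (\<tau> r) (s r)"
      by (auto simp: \<tau>_def s_def stack_tape_def input_tape_def blank_tape_def)
    with F[of s] obtain t \<tau>' where t: "t \<le> poly p (ssize s)" "\<forall>r. stack_tape (\<tau>' r) (F s r)"
      "(astep ^^ t) ([c], \<tau>) = ([], \<tau>')"
      unfolding runs_def by meson
    moreover have q0: "0 < length qs" "qs ! 0 = [c]" by (auto simp: qs_def)
    ultimately obtain t' q where "t' \<le> t" "qs ! q = []"
      "(step ?M ^^ t') (init ?M w) = (Run q, map \<tau>' rs)"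
      using steps_machine[of 0 t \<tau> \<tau>' e] by auto
    \<comment> \<open>The additional step is the one that tests tape \<open>e\<close> and halts; it
      accounts for the polynomial \<open>p + 1\<close>.\<close>
    then have "fst ((step ?M ^^ Suc t') (init ?M w)) = (if F s e = [] then Accept else Reject)"
      "Suc t' \<le> poly (p + 1) (length w)"
      using halt_machine[of q e \<tau>'] stack_read[of "\<tau>' e" "F s e"] t size by auto
    then show ?thesis unfolding s_def by blast
  qed
  then have "decides_in_time ?M {w. F ((\<lambda>_. [])(x := w)) e = []} (poly (p + 1))"
    unfolding decides_in_time_def by simp
  moreover have "wf_tm ?M"
    by (rule wf_machine) (auto simp: rs_def qs_def)
  ultimately show ?thesis
    unfolding in_P_def by blast
qed

section \<open>Sequencing, loop induction and constant growth\<close>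

definition seq :: "('s \<Rightarrow> 's) \<Rightarrow> ('s \<Rightarrow> 's) \<Rightarrow> 's \<Rightarrow> 's" (infixl "\<triangleright>" 60) where
  "(F \<triangleright> G) = G \<circ> F"

definition skip :: "'s \<Rightarrow> 's" where
  "skip = (\<lambda>s. s)"

lemma seq_apply [simp]: "(F \<triangleright> G) s = G (F s)"
  by (simp add: seq_def)

lemma skip_apply [simp]: "skip s = s"
  by (simp add: skip_def)

lemma ptime_seq [ptime]: "ptime F \<Longrightarrow> ptime G \<Longrightarrow> ptime (F \<triangleright> G)"
  unfolding seq_def by (rule ptime_comp)

lemma ptime_skip [ptime]: "ptime skip"
  unfolding skip_def by (rule ptime_id)

lemma ptime_if [ptime]: "ptime F \<Longrightarrow> ptime G \<Longrightarrow> ptime (if c then F else G)"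
  by simp

lemma ptime_case_option [ptime]:
  "ptime F \<Longrightarrow> (\<And>a. ptime (G a)) \<Longrightarrow> ptime (case x of None \<Rightarrow> F | Some a \<Rightarrow> G a)"
  by (cases x) auto

text \<open>The predicate relates a state to the result of the loop from there, because soundness
  argues backwards from a final state without error.\<close>

lemma loop_induct [case_names decrease stop step]:
  assumes "\<And>s. b (peek (s r)) \<Longrightarrow> length (F s r) < length (s r)"
    and "\<And>s. \<not> b (peek (s r)) \<Longrightarrow> P s s"
    and "\<And>s. b (peek (s r)) \<Longrightarrow> P (F s) (loop r b F (F s)) \<Longrightarrow> P s (loop r b F (F s))"
  shows "P s (loop r b F s)"
proof (induction "length (s r)" arbitrary: s rule: less_induct)
  case less
  show ?case
  proof (cases "b (peek (s r))")
    case True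
    have "P (F s) (loop r b F (F s))"
      by (rule less.hyps, rule assms(1), rule True)
    with True show ?thesis
      by (simp add: loop_unfold[of r b F s] assms(3))
  next
    case False
    then show ?thesis
      by (simp add: loop_unfold[of r b F s] assms(2))
  qed
qed

lemma loop_le:
  fixes m :: "_ \<Rightarrow> nat"
  assumes "\<And>s. b (peek (s r)) \<Longrightarrow> length (F s r) < length (s r)"
    and "\<And>s. b (peek (s r)) \<Longrightarrow> m (F s) \<le> m s"
  shows "m (loop r b F s) \<le> m s"
  by (rule loop_induct[where P = "\<lambda>s s'. m s' \<le> m s"]) (use assms in \<open>auto intro: order_trans\<close>)

lemma loop_same:
  assumes "\<And>s. b (peek (s r)) \<Longrightarrow> length (F s r) < length (s r)"
    and "\<And>s. b (peek (s r)) \<Longrightarrow> m (F s) = m s"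
  shows "m (loop r b F s) = m s"
  by (rule loop_induct[where P = "\<lambda>s s'. m s' = m s"]) (use assms in auto)

text \<open>Growth by a constant that does not depend on the state, as caused by a fixed number of
  pushes. A body of this kind may be iterated over a shrinking register without any further size
  analysis.\<close>

definition slow :: "(('r::finite \<Rightarrow> 'a list) \<Rightarrow> 'r \<Rightarrow> 'a list) \<Rightarrow> bool" where
  "slow F \<longleftrightarrow> (\<exists>k. \<forall>s. ssize (F s) \<le> ssize s + k)"

named_theorems slow

lemma slow_seq [slow]:
  assumes "slow F" "slow G"
  shows "slow (F \<triangleright> G)"
proof -
  from assms obtain k l where
    F: "\<And>s. ssize (F s) \<le> ssize s + k" and G: "\<And>s. ssize (G s) \<le> ssize s + l"
    unfolding slow_def by blast
  have "ssize (G (F s)) \<le> ssize s + (k + l)" for s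
    using F[of s] G[of "F s"] by linarith
  then show ?thesis
    unfolding slow_def by (auto simp: intro!: exI[of _ "k + l"])
qed

lemma slow_skip [slow]: "slow skip"
  unfolding slow_def by simp

lemma slow_if [slow]: "slow F \<Longrightarrow> slow G \<Longrightarrow> slow (if c then F else G)"
  by simp

lemma slow_case_option [slow]:
  "slow F \<Longrightarrow> (\<And>a. slow (G a)) \<Longrightarrow> slow (case x of None \<Rightarrow> F | Some a \<Rightarrow> G a)"
  by (cases x) auto

lemma slow_branch [slow]:
  fixes G :: "'a::finite option \<Rightarrow> ('r::finite \<Rightarrow> 'a list) \<Rightarrow> 'r \<Rightarrow> 'a list"
  assumes "\<And>x. slow (G x)"
  shows "slow (branch r G)"
proof -
  from assms obtain k where k: "\<And>x s. ssize (G x s) \<le> ssize s + k x"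
    unfolding slow_def by metis
  have "k x \<le> (\<Sum>x\<in>UNIV. k x)" for x
    by (rule member_le_sum) auto
  then have "ssize (branch r G s) \<le> ssize s + (\<Sum>x\<in>UNIV. k x)" for s
    unfolding branch_def using k by (meson add_left_mono order_trans)
  then show ?thesis unfolding slow_def by blast
qed

lemma slow_pop [slow]: "slow (pop r)"
  unfolding slow_def pop_def
proof (intro exI allI)
  fix s :: "'a \<Rightarrow> 'b list"
  show "ssize (s(r := tl (s r))) \<le> ssize s + 0"
    using ssize_upd[of s r "tl (s r)"] by simp
qed

lemma slow_push [slow]: "slow (push r a)"
  unfolding slow_def push_def
proof (intro exI allI)
  fix s :: "'a \<Rightarrow> 'b list"
  show "ssize (s(r := a # s r)) \<le> ssize s + 1"
    using ssize_upd[of s r "a # s r"] by simp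
qed

lemma ptime_loop_slow:
  assumes "ptime F" "slow F" "\<And>s. b (peek (s r)) \<Longrightarrow> length (F s r) < length (s r)"
  shows "ptime (loop r b F)"
proof -
  from assms(2) obtain k where "\<And>s. ssize (F s) \<le> ssize s + k"
    unfolding slow_def by blast
  with assms(1,3) show ?thesis
    by (intro ptime_loop[where g = "\<lambda>_. k"]) auto
qed

section \<open>Operations on registers\<close>

text \<open>\<^emph>\<open>Templ\<close> has one entry per agent, which is \<^term>\<open>One\<close> for the distinguished agent only; every row
  consumes a copy of it in \<^emph>\<open>Cols\<close>. \<^emph>\<open>Seen\<close> marks the item indices in the arrival order; when that
  is a permutation, it has one entry per item, and every row removes one. The sum accumulated so
  far is \<^emph>\<open>SumN / SumD\<close>, and \<^emph>\<open>NumI / DenI\<close> is the distinguished agent's utility for the current item.\<close>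

datatype reg = Inp | Err | Tmp | Flag | Fac1 | Fac2 | Addend | Total | Agent | Templ | Aux | Seen |
  Cols | Bidders | Numer | Denom | NumI | DenI | SumN | SumD

instance reg :: finite
proof
  have "(UNIV :: reg set) \<subseteq> {Inp, Err, Tmp, Flag, Fac1, Fac2, Addend, Total, Agent, Templ, Aux, Seen,
      Cols, Bidders, Numer, Denom, NumI, DenI, SumN, SumD}"
    by (auto intro: reg.exhaust)
  then show "finite (UNIV :: reg set)"
    by (rule finite_subset) simp
qed

type_synonym store = "reg \<Rightarrow> letter list"

definition nonempty :: "'a option \<Rightarrow> bool" where
  "nonempty x \<longleftrightarrow> x \<noteq> None"

lemma nonempty_peek [simp]: "nonempty (peek xs) \<longleftrightarrow> xs \<noteq> []" "nonempty (Some a)" "\<not> nonempty None"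
  by (auto simp: nonempty_def)

lemma loop_empty [simp]: "s r = [] \<Longrightarrow> loop r nonempty F s = s"
  by (simp add: loop_unfold[of _ _ _ s])

section \<open>Moving and copying stacks\<close>

definition clear :: "reg \<Rightarrow> store \<Rightarrow> store" where
  "clear r = loop r nonempty (pop r)"

lemma clear_apply [simp]: "clear r s = s(r := [])"
proof (induction "s r" arbitrary: s)
  case Nil
  then show ?case by (simp add: clear_def loop_unfold[of _ _ _ s] fun_upd_idem)
next
  case (Cons x xs)
  have "clear r s = clear r (pop r s)"
    by (simp add: clear_def loop_unfold[of _ _ _ s] flip: Cons.hyps(2))
  then show ?case
    using Cons.hyps(1)[of "pop r s"] by (simp add: pop_def flip: Cons.hyps(2))
qed

lemma ptime_clear [ptime]: "ptime (clear r)"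
  unfolding clear_def
  by (rule ptime_loop_slow) (auto simp: pop_def intro!: ptime slow)

lemma slow_clear [slow]: "slow (clear r)"
  unfolding slow_def
proof (intro exI allI)
  show "ssize (clear r s) \<le> ssize s + 0" for s
    using ssize_upd[of s r "[]"] by simp
qed

definition mv :: "reg \<Rightarrow> reg \<Rightarrow> store \<Rightarrow> store" where
  "mv r q = branch r (\<lambda>x. case x of None \<Rightarrow> skip | Some a \<Rightarrow> pop r \<triangleright> push q a)"

lemma mv_Nil [simp]: "s r = [] \<Longrightarrow> mv r q s = s"
  by (simp add: mv_def branch_def)

lemma mv_Cons: "s r = x # xs \<Longrightarrow> r \<noteq> q \<Longrightarrow> mv r q s = s(r := xs, q := x # s q)"
  by (auto simp: mv_def branch_def pop_def push_def fun_eq_iff)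

lemma ptime_mv [ptime]: "ptime (mv r q)"
  unfolding mv_def by (intro ptime)

lemma ssize_mv: "r \<noteq> q \<Longrightarrow> ssize (mv r q s) = ssize s"
proof (cases "s r")
  case (Cons x xs)
  assume "r \<noteq> q"
  then show ?thesis
    using ssize_upd[of s r xs] ssize_upd[of "s(r := xs)" q "x # s q"] Cons by (simp add: mv_Cons)
qed simp

lemma slow_mv [slow]: "slow (mv r q)"
  unfolding mv_def by (intro slow)

text \<open>Moving a prefix reverses it. A numeral written with its most significant bit first thus
  arrives with the least significant bit on top, the order in which the arithmetic works.\<close>

definition span :: "(letter \<Rightarrow> bool) \<Rightarrow> reg \<Rightarrow> reg \<Rightarrow> store \<Rightarrow> store" where
  "span p r q = loop r (\<lambda>x. case x of None \<Rightarrow> False | Some a \<Rightarrow> p a) (mv r q)"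

lemma span_apply [simp]:
  assumes "r \<noteq> q"
  shows "span p r q s = s(r := dropWhile p (s r), q := rev (takeWhile p (s r)) @ s q)"
proof (induction "s r" arbitrary: s)
  case Nil
  then show ?case
    using assms by (auto simp: span_def loop_unfold[of _ _ _ s] fun_eq_iff simp flip: Nil)
next
  case (Cons x xs)
  show ?case
  proof (cases "p x")
    case True
    then have "span p r q s = span p r q (mv r q s)"
      by (simp add: span_def loop_unfold[of _ _ _ s] flip: Cons.hyps(2))
    then show ?thesis
      using Cons.hyps(1)[of "mv r q s"] True assms
      by (simp add: mv_Cons[of s r, OF Cons.hyps(2)[symmetric]] fun_upd_twist flip: Cons.hyps(2))
  next
    case False
    then show ?thesis
      using assms by (auto simp: span_def loop_unfold[of _ _ _ s] fun_eq_iff simp flip: Cons.hyps(2))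
  qed
qed

lemma ptime_span [ptime]: "r \<noteq> q \<Longrightarrow> ptime (span p r q)"
  unfolding span_def
proof (rule ptime_loop_slow)
  fix s :: store
  assume "r \<noteq> q" "case peek (s r) of None \<Rightarrow> False | Some a \<Rightarrow> p a"
  then show "length (mv r q s r) < length (s r)"
    by (cases "s r") (auto simp: mv_Cons)
qed (intro ptime slow)+

lemma slow_span [slow]: "r \<noteq> q \<Longrightarrow> slow (span p r q)"
  unfolding slow_def span_def
proof (intro exI allI)
  fix s :: store
  assume "r \<noteq> q"
  then have "ssize (loop r (\<lambda>x. case x of None \<Rightarrow> False | Some a \<Rightarrow> p a) (mv r q) s) \<le> ssize s"
  proof (intro loop_le)
    fix s :: store
    assume "case peek (s r) of None \<Rightarrow> False | Some a \<Rightarrow> p a"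
    then show "length (mv r q s r) < length (s r)"
      using \<open>r \<noteq> q\<close> by (cases "s r") (auto simp: mv_Cons)
  qed (simp add: ssize_mv)
  then show "ssize (loop r (\<lambda>x. case x of None \<Rightarrow> False | Some a \<Rightarrow> p a) (mv r q) s) \<le> ssize s + 0"
    by simp
qed

definition pour :: "reg \<Rightarrow> reg \<Rightarrow> store \<Rightarrow> store" where
  "pour r q = span (\<lambda>_. True) r q"

lemma pour_apply [simp]: "r \<noteq> q \<Longrightarrow> pour r q s = s(r := [], q := rev (s r) @ s q)"
proof -
  have "takeWhile (\<lambda>_. True) xs = xs \<and> dropWhile (\<lambda>_. True) xs = []" for xs :: "letter list"
    by (induction xs) auto
  note this[simp]
  show "r \<noteq> q \<Longrightarrow> ?thesis" by (simp add: pour_def)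
qed

lemma ptime_pour [ptime]: "r \<noteq> q \<Longrightarrow> ptime (pour r q)"
  unfolding pour_def by (rule ptime_span)

lemma slow_pour [slow]: "r \<noteq> q \<Longrightarrow> slow (pour r q)"
  unfolding pour_def by (rule slow_span)

definition transfer :: "reg \<Rightarrow> reg \<Rightarrow> store \<Rightarrow> store" where
  "transfer r q = clear q \<triangleright> clear Tmp \<triangleright> pour r Tmp \<triangleright> pour Tmp q"

lemma transfer_apply [simp]:
  "distinct [r, q, Tmp] \<Longrightarrow> transfer r q s = s(q := s r, r := [], Tmp := [])"
  by (auto simp: transfer_def fun_eq_iff)

lemma ptime_transfer [ptime]: "r \<noteq> Tmp \<Longrightarrow> q \<noteq> Tmp \<Longrightarrow> ptime (transfer r q)"
  unfolding transfer_def by (intro ptime) auto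

lemma slow_transfer [slow]: "r \<noteq> Tmp \<Longrightarrow> q \<noteq> Tmp \<Longrightarrow> slow (transfer r q)"
  unfolding transfer_def by (intro slow) auto

definition dup :: "reg \<Rightarrow> reg \<Rightarrow> store \<Rightarrow> store" where
  "dup r q = branch Tmp (\<lambda>x. case x of None \<Rightarrow> skip | Some a \<Rightarrow> pop Tmp \<triangleright> push r a \<triangleright> push q a)"

definition copy :: "reg \<Rightarrow> reg \<Rightarrow> store \<Rightarrow> store" where
  "copy r q = clear q \<triangleright> clear Tmp \<triangleright> pour r Tmp \<triangleright> loop Tmp nonempty (dup r q)"

lemma dup_loop:
  assumes "distinct [r, q, Tmp]"
  shows "loop Tmp nonempty (dup r q) s =
    s(r := rev (s Tmp) @ s r, q := rev (s Tmp) @ s q, Tmp := [])"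
proof (induction "s Tmp" arbitrary: s)
  case Nil
  then show ?case using assms by (auto simp: loop_unfold[of _ _ _ s] fun_eq_iff simp flip: Nil)
next
  case (Cons x xs)
  have *: "dup r q s = s(r := x # s r, q := x # s q, Tmp := xs)"
    using assms by (auto simp: dup_def branch_def pop_def push_def fun_eq_iff simp flip: Cons.hyps(2))
  then have "loop Tmp nonempty (dup r q) s = loop Tmp nonempty (dup r q) (s(r := x # s r, q := x # s q, Tmp := xs))"
    by (simp add: loop_unfold[of _ _ _ s] flip: Cons.hyps(2))
  then show ?case
    using Cons.hyps(1)[of "s(r := x # s r, q := x # s q, Tmp := xs)"] assms
    by (auto simp: fun_eq_iff simp flip: Cons.hyps(2))
qed

lemma copy_apply [simp]: "distinct [r, q, Tmp] \<Longrightarrow> copy r q s = s(q := s r, Tmp := [])"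
  by (auto simp: copy_def dup_loop fun_eq_iff)

lemma ptime_copy [ptime]:
  assumes "r \<noteq> Tmp" "q \<noteq> Tmp"
  shows "ptime (copy r q)"
proof -
  have "ptime (loop Tmp nonempty (dup r q))"
  proof (rule ptime_loop_slow)
    show "ptime (dup r q)" "slow (dup r q)"
      unfolding dup_def by (intro ptime slow)+
    show "nonempty (peek (s Tmp)) \<Longrightarrow> length (dup r q s Tmp) < length (s Tmp)" for s
      using assms by (cases "s Tmp") (auto simp: dup_def branch_def pop_def push_def)
  qed
  then show ?thesis
    using assms unfolding copy_def by (intro ptime) auto
qed

lemma ssize_copy: "distinct [r, q, Tmp] \<Longrightarrow> ssize (copy r q s) \<le> ssize s + length (s r)"
  using ssize_upd[of s q "s r"] ssize_upd[of "s(q := s r)" Tmp "[]"] by simp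

definition put :: "reg \<Rightarrow> letter \<Rightarrow> store \<Rightarrow> store" where
  "put r a = clear r \<triangleright> push r a"

lemma put_apply [simp]: "put r a s = s(r := [a])"
  by (simp add: put_def push_def)

lemma ptime_put [ptime]: "ptime (put r a)"
  unfolding put_def by (intro ptime)

lemma slow_put [slow]: "slow (put r a)"
  unfolding put_def by (intro slow)

subsection \<open>Binary arithmetic\<close>

text \<open>Numbers are kept with the least significant bit on top; every letter other than
  \<^term>\<open>One\<close> counts as zero.\<close>

fun val :: "letter list \<Rightarrow> nat" where
  "val [] = 0"
| "val (x # xs) = of_bool (x = One) + 2 * val xs"

definition bit :: "bool \<Rightarrow> letter" where
  "bit b = (if b then One else Zero)"

lemma bit_One [simp]: "bit b = One \<longleftrightarrow> b"
  by (simp add: bit_def)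

definition maj :: "bool \<Rightarrow> bool \<Rightarrow> bool \<Rightarrow> bool" where
  "maj a b c \<longleftrightarrow> a \<and> b \<or> a \<and> c \<or> b \<and> c"

lemma adder: "of_bool ((a \<noteq> b) \<noteq> c) + 2 * of_bool (maj a b c) = (of_bool a + of_bool b + of_bool c :: nat)"
  by (cases a; cases b; cases c) (auto simp: maj_def)

text \<open>Ripple-carry addition, with clauses shaped after the two loops of \<open>add\<close>:
  first \<open>x\<close> drives the recursion, then what is left of \<open>y\<close>.\<close>

fun addl :: "bool \<Rightarrow> letter list \<Rightarrow> letter list \<Rightarrow> letter list" where
  "addl c [] [] = (if c then [One] else [])"
| "addl c (x # xs) ys = bit (((x = One) \<noteq> (peek ys = Some One)) \<noteq> c) #
     addl (maj (x = One) (peek ys = Some One) c) xs (tl ys)"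
| "addl c [] (y # ys) = bit ((y = One) \<noteq> c) # addl (y = One \<and> c) [] ys"

lemma val_tl: "val ys = of_bool (peek ys = Some One) + 2 * val (tl ys)"
  by (cases ys) auto

lemma val_addl: "val (addl c xs ys) = val xs + val ys + of_bool c"
proof (induction c xs ys rule: addl.induct)
  case (2 c x xs ys)
  then show ?case
    using val_tl[of ys] adder[of "x = One" "peek ys = Some One" c] by (simp add: algebra_simps)
qed auto

lemma length_addl: "length (addl c xs ys) \<le> max (length xs) (length ys) + 1"
  by (induction c xs ys rule: addl.induct) (auto split: if_splits)

definition addstep :: "reg \<Rightarrow> reg \<Rightarrow> store \<Rightarrow> store" where
  "addstep x y = branch x (\<lambda>a. branch y (\<lambda>b. branch Flag (\<lambda>c.
     pop x \<triangleright> pop y \<triangleright> push Tmp (bit (((a = Some One) \<noteq> (b = Some One)) \<noteq> nonempty c)) \<triangleright>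
     (if maj (a = Some One) (b = Some One) (nonempty c) then put Flag Mark else clear Flag))))"

definition add :: "reg \<Rightarrow> reg \<Rightarrow> store \<Rightarrow> store" where
  "add x y = clear Tmp \<triangleright> clear Flag \<triangleright> loop x nonempty (addstep x y) \<triangleright> loop y nonempty (addstep x y) \<triangleright>
     branch Flag (\<lambda>c. if nonempty c then clear Flag \<triangleright> push Tmp One else skip) \<triangleright> pour Tmp x"

abbreviation flag :: "bool \<Rightarrow> letter list" where
  "flag b \<equiv> (if b then [Mark] else [])"

lemma addstep_apply:
  assumes "distinct [x, y, Tmp, Flag]" "s Flag = flag c"
  shows "addstep x y s = s(x := tl (s x), y := tl (s y),
    Tmp := bit (((peek (s x) = Some One) \<noteq> (peek (s y) = Some One)) \<noteq> c) # s Tmp,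
    Flag := flag (maj (peek (s x) = Some One) (peek (s y) = Some One) c))"
  using assms by (auto simp: addstep_def branch_def pop_def push_def fun_eq_iff)

lemma add_loops:
  assumes d: "distinct [x, y, Tmp, Flag]" and "s Flag = flag c"
  shows "branch Flag (\<lambda>c. if nonempty c then clear Flag \<triangleright> push Tmp One else skip)
      (loop y nonempty (addstep x y) (loop x nonempty (addstep x y) s)) =
    s(x := [], y := [], Flag := [], Tmp := rev (addl c (s x) (s y)) @ s Tmp)"
  using assms(2)
proof (induction c "s x" "s y" arbitrary: s rule: addl.induct)
  case (1 c)
  note xy = 1(1,2)[symmetric]
  show ?case using 1(3) d by (auto simp: xy branch_def push_def fun_eq_iff)
next
  case (2 c a as)
  note x = 2(2)[symmetric]
  note step = addstep_apply[of x y s, OF d 2(3)]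
  have loop: "loop x nonempty (addstep x y) s = loop x nonempty (addstep x y) (addstep x y s)"
    by (simp add: loop_unfold[of _ _ _ s] x)
  have "addstep x y s x = as" "addstep x y s y = tl (s y)"
    "addstep x y s Flag = flag (maj (a = One) (peek (s y) = Some One) c)"
    using d by (auto simp: step x)
  note IH = 2(1)[OF this(1,2)[symmetric] this(3)]
  show ?case
    unfolding loop IH using d by (auto simp: step x fun_eq_iff)
next
  case (3 c b bs)
  note xy = 3(2,3)[symmetric]
  note step = addstep_apply[of x y s, OF d 3(4)]
  have "addstep x y s x = []" "addstep x y s y = bs"
    "addstep x y s Flag = flag (b = One \<and> c)"
    using d by (auto simp: step xy maj_def)
  note IH = 3(1)[OF this(1,2)[symmetric] this(3)]
  \<comment> \<open>The induction hypothesis speaks of both loops, so the finished loop over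
    \<open>x\<close> is put back; on an empty register it changes nothing.\<close>
  have loop: "loop y nonempty (addstep x y) (loop x nonempty (addstep x y) s) =
      loop y nonempty (addstep x y) (loop x nonempty (addstep x y) (addstep x y s))"
    using \<open>addstep x y s x = []\<close> by (simp add: loop_unfold[of y _ _ s] xy)
  show ?case
    unfolding loop IH using d by (auto simp: step xy fun_eq_iff maj_def)
qed

lemma add_apply [simp]:
  assumes "distinct [x, y, Tmp, Flag]"
  shows "add x y s = s(x := addl False (s x) (s y), y := [], Tmp := [], Flag := [])"
  using assms add_loops[OF assms, of "s(Tmp := [], Flag := [])" False]
  by (auto simp: add_def fun_eq_iff)

lemma slow_addstep: "slow (addstep x y)"
  unfolding addstep_def by (intro slow)

lemma ptime_addstep: "ptime (addstep x y)"
  unfolding addstep_def by (intro ptime)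

lemma ptime_add [ptime]:
  assumes "distinct [x, y, Tmp, Flag]"
  shows "ptime (add x y)"
proof -
  have "length (addstep x y s r) < length (s r)" if "nonempty (peek (s r))" "r = x \<or> r = y" for r s
    using assms that by (auto simp: addstep_def branch_def pop_def push_def)
  then have "ptime (loop x nonempty (addstep x y))" "ptime (loop y nonempty (addstep x y))"
    by (auto intro!: ptime_loop_slow ptime_addstep slow_addstep)
  then show ?thesis
    using assms unfolding add_def by (intro ptime) auto
qed

lemma ssize_add:
  assumes "distinct [x, y, Tmp, Flag]"
  shows "ssize (add x y s) \<le> ssize s + 1"
  using assms ssize_upd[of s x "addl False (s x) (s y)"]
    ssize_upd[of "s(x := addl False (s x) (s y))" y "[]"]
    ssize_upd[of "s(x := addl False (s x) (s y), y := [])" Tmp "[]"]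
    ssize_upd[of "s(x := addl False (s x) (s y), y := [], Tmp := [])" Flag "[]"]
    length_addl[of False "s x" "s y"]
  by auto

lemma slow_add [slow]: "distinct [x, y, Tmp, Flag] \<Longrightarrow> slow (add x y)"
  unfolding slow_def using ssize_add by blast

fun mulacc :: "letter list \<Rightarrow> letter list \<Rightarrow> letter list \<Rightarrow> letter list" where
  "mulacc zs [] ys = zs"
| "mulacc zs (x # xs) ys = mulacc (if x = One then addl False zs ys else zs) xs (Zero # ys)"

lemma val_mulacc: "val (mulacc zs xs ys) = val zs + val xs * val ys"
  by (induction zs xs ys rule: mulacc.induct) (auto simp: val_addl algebra_simps)

text \<open>In shift-and-add multiplication the accumulator bound and the shifted factor gain at
  most one letter per bit of the multiplier. So lengths add up, and repeated products stay linear in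
  the total length of their factors.\<close>

lemma length_mulacc: "length (mulacc zs xs ys) \<le> max (length zs) (length ys) + length xs"
proof (induction zs xs ys rule: mulacc.induct)
  case (2 zs x xs ys)
  then show ?case using length_addl[of False zs ys] by (auto split: if_splits)
qed simp

definition mulstep :: "reg \<Rightarrow> store \<Rightarrow> store" where
  "mulstep r = branch Fac1 (\<lambda>x. pop Fac1 \<triangleright>
     (if x = Some One then copy Fac2 Addend \<triangleright> add r Addend else skip)) \<triangleright> push Fac2 Zero"

definition mul :: "reg \<Rightarrow> reg \<Rightarrow> store \<Rightarrow> store" where
  "mul r q = transfer r Fac1 \<triangleright> copy q Fac2 \<triangleright> loop Fac1 nonempty (mulstep r) \<triangleright>
     clear Fac2 \<triangleright> clear Addend \<triangleright> clear Tmp \<triangleright> clear Flag"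

lemma mulstep_Cons:
  assumes "distinct [r, Fac1, Fac2, Addend, Tmp, Flag]" "s Fac1 = x # xs"
  shows "mulstep r s = (if x = One then s(Fac1 := xs, Fac2 := Zero # s Fac2,
     r := addl False (s r) (s Fac2), Addend := [], Tmp := [], Flag := [])
     else s(Fac1 := xs, Fac2 := Zero # s Fac2))"
  using assms by (auto simp: mulstep_def branch_def pop_def push_def fun_eq_iff)

text \<open>What remains in the scratch registers depends on the bits of the multiplier, so it is
  left existential; \<open>mul\<close> clears these registers afterwards.\<close>

lemma mul_loop:
  assumes d: "distinct [r, Fac1, Fac2, Addend, Tmp, Flag]"
  shows "\<exists>a b c d. loop Fac1 nonempty (mulstep r) s =
    s(r := mulacc (s r) (s Fac1) (s Fac2), Fac1 := [], Fac2 := a, Addend := b, Tmp := c, Flag := d)"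
proof (induction "s Fac1" arbitrary: s)
  case Nil
  have "loop Fac1 nonempty (mulstep r) s = s(r := mulacc (s r) (s Fac1) (s Fac2), Fac1 := [],
      Fac2 := s Fac2, Addend := s Addend, Tmp := s Tmp, Flag := s Flag)"
    using d by (auto simp: loop_unfold[of _ _ _ s] fun_eq_iff simp flip: Nil)
  then show ?case by blast
next
  case (Cons x xs)
  note x = Cons.hyps(2)[symmetric]
  note step = mulstep_Cons[of r s, OF d x]
  have "loop Fac1 nonempty (mulstep r) s = loop Fac1 nonempty (mulstep r) (mulstep r s)"
    by (simp add: loop_unfold[of _ _ _ s] x)
  moreover have "mulstep r s Fac1 = xs"
    using step d by auto
  from Cons.hyps(1)[of "mulstep r s", OF this[symmetric]] obtain a b c e where
    "loop Fac1 nonempty (mulstep r) (mulstep r s) =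
      (mulstep r s)(r := mulacc (mulstep r s r) (mulstep r s Fac1) (mulstep r s Fac2), Fac1 := [],
        Fac2 := a, Addend := b, Tmp := c, Flag := e)"
    by blast
  ultimately have "loop Fac1 nonempty (mulstep r) s = s(r := mulacc (s r) (s Fac1) (s Fac2),
      Fac1 := [], Fac2 := a, Addend := b, Tmp := c, Flag := e)"
    using d by (auto simp: step x fun_eq_iff)
  then show ?case by blast
qed

lemma mul_apply [simp]:
  assumes "distinct [r, q, Fac1, Fac2, Addend, Tmp, Flag]"
  shows "mul r q s = s(r := mulacc [] (s r) (s q), Fac1 := [], Fac2 := [], Addend := [], Tmp := [], Flag := [])"
proof -
  have d: "distinct [r, Fac1, Fac2, Addend, Tmp, Flag]" using assms by auto
  show ?thesis
    using mul_loop[OF d, of "copy q Fac2 (transfer r Fac1 s)"] assms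
    by (auto simp: mul_def fun_eq_iff)
qed

lemma ptime_mul [ptime]:
  assumes "distinct [r, q, Fac1, Fac2, Addend, Tmp, Flag]"
  shows "ptime (mul r q)"
proof -
  have d: "distinct [r, Fac1, Fac2, Addend, Tmp, Flag]" using assms by auto
  have ptime_step: "ptime (mulstep r)"
    using assms unfolding mulstep_def by (intro ptime) auto
  have "ptime (loop Fac1 nonempty (mulstep r))"
  \<comment> \<open>A round adds a copy of \<open>Fac2\<close>, one letter for the addition and one
    for the shift. \<open>Fac2\<close> grows, but \<open>Fac1\<close> shrinks by as much, so
    including \<open>Fac1\<close> keeps the bound from increasing.\<close>
  proof (rule ptime_loop[where g = "\<lambda>s. length (s Fac1) + length (s Fac2) + 2"])
    fix s :: store
    assume "nonempty (peek (s Fac1))"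
    then obtain x xs where c: "s Fac1 = x # xs" by (cases "s Fac1") auto
    show "length (mulstep r s Fac1) < length (s Fac1)"
      "length (mulstep r s Fac1) + length (mulstep r s Fac2) + 2 \<le> length (s Fac1) + length (s Fac2) + 2"
      using mulstep_Cons[of r s, OF d c] c d by auto
    let ?s = "if x = One then add r Addend (copy Fac2 Addend (pop Fac1 s)) else pop Fac1 s"
    have 1: "ssize (pop Fac1 s) \<le> ssize s" using ssize_upd[of s Fac1 "tl (s Fac1)"] by (simp add: pop_def)
    have 2: "ssize (copy Fac2 Addend (pop Fac1 s)) \<le> ssize (pop Fac1 s) + length (s Fac2)"
      using ssize_copy[of Fac2 Addend "pop Fac1 s"] by (simp add: pop_def)
    have 3: "ssize ?s \<le> ssize s + length (s Fac2) + 1"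
      using 1 2 ssize_add[of r Addend "copy Fac2 Addend (pop Fac1 s)"] d by auto
    have "mulstep r s = push Fac2 Zero ?s"
      by (simp add: mulstep_def branch_def c)
    then have "ssize (mulstep r s) = ssize ?s + 1"
      using ssize_upd[of ?s Fac2 "Zero # ?s Fac2"] by (simp add: push_def)
    then show "ssize (mulstep r s) \<le> ssize s + (length (s Fac1) + length (s Fac2) + 2)"
      using 3 by simp
  qed (intro ptime_step polybd_add polybd_length polybd_const)+
  then show ?thesis
    using assms unfolding mul_def by (intro ptime) auto
qed

text \<open>The least significant bits come first, so a later difference overrules an earlier
  verdict \<open>c\<close>. Starting with \<open>True\<close> makes the comparison
  non-strict.\<close>

fun cmpl :: "bool \<Rightarrow> letter list \<Rightarrow> letter list \<Rightarrow> bool" where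
  "cmpl c [] [] = c"
| "cmpl c (x # xs) ys = cmpl (if (x = One) = (peek ys = Some One) then c else x = One) xs (tl ys)"
| "cmpl c [] (y # ys) = cmpl (c \<and> y \<noteq> One) [] ys"

lemma cmpl_iff: "cmpl c xs ys \<longleftrightarrow> (if c then val ys \<le> val xs else val ys < val xs)"
proof (induction c xs ys rule: cmpl.induct)
  case (2 c x xs ys)
  then show ?case using val_tl[of ys] by auto
qed auto

definition cmpstep :: "reg \<Rightarrow> reg \<Rightarrow> store \<Rightarrow> store" where
  "cmpstep x y = branch x (\<lambda>a. branch y (\<lambda>b. pop x \<triangleright> pop y \<triangleright>
     (if (a = Some One) = (b = Some One) then skip else if a = Some One then put Flag Mark else clear Flag)))"

definition compare :: "reg \<Rightarrow> reg \<Rightarrow> store \<Rightarrow> store" where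
  "compare x y = put Flag Mark \<triangleright> loop x nonempty (cmpstep x y) \<triangleright> loop y nonempty (cmpstep x y)"

lemma cmpstep_apply:
  assumes "distinct [x, y, Flag]" "s Flag = flag c"
  shows "cmpstep x y s = s(x := tl (s x), y := tl (s y), Flag := flag
     (if (peek (s x) = Some One) = (peek (s y) = Some One) then c else peek (s x) = Some One))"
  using assms by (auto simp: cmpstep_def branch_def pop_def fun_eq_iff)

lemma cmp_loops:
  assumes d: "distinct [x, y, Flag]" and "s Flag = flag c"
  shows "loop y nonempty (cmpstep x y) (loop x nonempty (cmpstep x y) s) =
    s(x := [], y := [], Flag := flag (cmpl c (s x) (s y)))"
  using assms(2)
proof (induction c "s x" "s y" arbitrary: s rule: cmpl.induct)
  case (1 c)
  note xy = 1(1,2)[symmetric]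
  show ?case using 1(3) d by (auto simp: xy fun_eq_iff)
next
  case (2 c a as)
  note x = 2(2)[symmetric]
  note step = cmpstep_apply[of x y s, OF d 2(3)]
  have loop: "loop x nonempty (cmpstep x y) s = loop x nonempty (cmpstep x y) (cmpstep x y s)"
    by (simp add: loop_unfold[of _ _ _ s] x)
  have "cmpstep x y s x = as" "cmpstep x y s y = tl (s y)"
    "cmpstep x y s Flag = flag (if (a = One) = (peek (s y) = Some One) then c else a = One)"
    using d by (auto simp: step x)
  note IH = 2(1)[OF this(1,2)[symmetric] this(3)]
  show ?case
    unfolding loop IH using d by (auto simp: step x fun_eq_iff)
next
  case (3 c b bs)
  note xy = 3(2,3)[symmetric]
  note step = cmpstep_apply[of x y s, OF d 3(4)]
  have "cmpstep x y s x = []" "cmpstep x y s y = bs"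
    "cmpstep x y s Flag = flag (c \<and> b \<noteq> One)"
    using d by (auto simp: step xy)
  note IH = 3(1)[OF this(1,2)[symmetric] this(3)]
  have loop: "loop y nonempty (cmpstep x y) (loop x nonempty (cmpstep x y) s) =
      loop y nonempty (cmpstep x y) (loop x nonempty (cmpstep x y) (cmpstep x y s))"
    using \<open>cmpstep x y s x = []\<close> by (simp add: loop_unfold[of y _ _ s] xy)
  show ?case
    unfolding loop IH using d by (auto simp: step xy fun_eq_iff)
qed

lemma compare_apply [simp]:
  assumes "distinct [x, y, Flag]"
  shows "compare x y s = s(x := [], y := [], Flag := flag (val (s y) \<le> val (s x)))"
  using assms cmp_loops[OF assms, of "s(Flag := [Mark])" True]
  by (auto simp: compare_def cmpl_iff fun_eq_iff)

lemma ptime_compare [ptime]: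
  assumes "distinct [x, y, Flag]"
  shows "ptime (compare x y)"
proof -
  have "length (cmpstep x y s r) < length (s r)" if "nonempty (peek (s r))" "r = x \<or> r = y" for r s
    using assms that by (auto simp: cmpstep_def branch_def pop_def)
  moreover have "ptime (cmpstep x y)" "slow (cmpstep x y)"
    unfolding cmpstep_def by (intro ptime slow)+
  ultimately have "ptime (loop x nonempty (cmpstep x y))" "ptime (loop y nonempty (cmpstep x y))"
    by (auto intro!: ptime_loop_slow)
  then show ?thesis
    using assms unfolding compare_def by (intro ptime) auto
qed

definition scan :: "store \<Rightarrow> store" where
  "scan = branch Fac1 (\<lambda>x. pop Fac1 \<triangleright> (if x = Some One then put Flag Mark else skip))"

definition has_one :: "reg \<Rightarrow> store \<Rightarrow> store" where
  "has_one r = copy r Fac1 \<triangleright> clear Flag \<triangleright> loop Fac1 nonempty scan"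

lemma scan_loop:
  "loop Fac1 nonempty scan s = s(Fac1 := [], Flag := if One \<in> set (s Fac1) then [Mark] else s Flag)"
proof (induction "s Fac1" arbitrary: s)
  case Nil
  then show ?case by (auto simp: loop_unfold[of _ _ _ s] fun_eq_iff simp flip: Nil)
next
  case (Cons x xs)
  note Cons.hyps(2)[symmetric, simp]
  have s: "scan s = s(Fac1 := xs, Flag := if x = One then [Mark] else s Flag)"
    by (auto simp: scan_def branch_def pop_def fun_eq_iff)
  show ?case
    using Cons.hyps(1)[of "scan s"] by (auto simp: loop_unfold[of _ _ _ s] s fun_eq_iff)
qed

lemma has_one_apply [simp]:
  "distinct [r, Fac1, Flag, Tmp] \<Longrightarrow>
   has_one r s = s(Fac1 := [], Tmp := [], Flag := flag (One \<in> set (s r)))"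
  by (auto simp: has_one_def scan_loop fun_eq_iff)

lemma ptime_has_one [ptime]: "r \<noteq> Tmp \<Longrightarrow> ptime (has_one r)"
proof -
  assume "r \<noteq> Tmp"
  moreover have "ptime (loop Fac1 nonempty scan)"
    by (rule ptime_loop_slow) (auto simp: scan_def branch_def pop_def intro!: ptime slow)
  ultimately show ?thesis
    unfolding has_one_def by (intro ptime) auto
qed

text \<open>Copying by itself is not slow, but here the copy is consumed by the scan; hence the
  argument from the closed form of the result.\<close>

lemma slow_has_one [slow]: "distinct [r, Fac1, Flag, Tmp] \<Longrightarrow> slow (has_one r)"
  unfolding slow_def
proof (intro exI[of _ 1] allI)
  fix s :: store
  assume "distinct [r, Fac1, Flag, Tmp]"
  then show "ssize (has_one r s) \<le> ssize s + 1"
    using ssize_upd[of s Fac1 "[]"] ssize_upd[of "s(Fac1 := [])" Tmp "[]"]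
      ssize_upd[of "s(Fac1 := [], Tmp := [])" Flag "flag (One \<in> set (s r))"] by auto
qed

section \<open>The decision procedure\<close>

text \<open>A violation of the input format is recorded in \<^term>\<open>Err\<close> and the computation goes on,
  so every part of the program is a total function on states.\<close>

definition fail :: "store \<Rightarrow> store" where
  "fail = put Err Mark"

lemma fail_apply [simp]: "fail s = s(Err := [Mark])"
  by (simp add: fail_def)

lemma ptime_fail [ptime]: "ptime fail" and slow_fail [slow]: "slow fail"
  unfolding fail_def by (intro ptime slow)+

text \<open>The letter is removed even when it is the wrong one, so loops around this test make
  progress on malformed input too.\<close>

definition expect :: "letter \<Rightarrow> store \<Rightarrow> store" where
  "expect a = branch Inp (\<lambda>x. pop Inp \<triangleright> (if x = Some a then skip else fail))"

lemma expect_apply [simp]: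
  "expect a s = s(Inp := tl (s Inp), Err := if peek (s Inp) = Some a then s Err else [Mark])"
  by (auto simp: expect_def branch_def pop_def fun_eq_iff)

lemma ptime_expect [ptime]: "ptime (expect a)" and slow_expect [slow]: "slow (expect a)"
  unfolding expect_def by (intro ptime slow)+

definition need :: "reg \<Rightarrow> store \<Rightarrow> store" where
  "need r = branch r (\<lambda>x. if nonempty x then skip else fail)"

lemma need_apply [simp]: "need r s = s(Err := if s r \<noteq> [] then s Err else [Mark])"
  by (auto simp: need_def branch_def fun_eq_iff)

lemma ptime_need [ptime]: "ptime (need r)" and slow_need [slow]: "slow (need r)"
  unfolding need_def by (intro ptime slow)+

definition need_empty :: "reg \<Rightarrow> store \<Rightarrow> store" where
  "need_empty r = branch r (\<lambda>x. if nonempty x then fail else skip)"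

lemma need_empty_apply [simp]: "need_empty r s = s(Err := if s r = [] then s Err else [Mark])"
  by (auto simp: need_empty_def branch_def fun_eq_iff)

lemma ptime_need_empty [ptime]: "ptime (need_empty r)" and slow_need_empty [slow]: "slow (need_empty r)"
  unfolding need_empty_def by (intro ptime slow)+

lemma pop_apply [simp]: "pop r s = s(r := tl (s r))"
  by (simp add: pop_def)

lemma push_apply [simp]: "push r a s = s(r := a # s r)"
  by (simp add: push_def)

definition digit :: "letter \<Rightarrow> bool" where
  "digit a \<longleftrightarrow> a = Zero \<or> a = One"

text \<open>A loop guard that also fails at the end of the input, so a missing delimiter cannot keep
  a loop running.\<close>

definition before :: "letter set \<Rightarrow> letter option \<Rightarrow> bool" where
  "before A x = (case x of None \<Rightarrow> False | Some a \<Rightarrow> a \<notin> A)"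

lemma before_simps [simp]: "\<not> before A None" "before A (Some a) \<longleftrightarrow> a \<notin> A"
  by (auto simp: before_def)

lemma before_Cons: "before A (peek xs) \<Longrightarrow> xs \<noteq> []"
  by (cases xs) auto

subsection \<open>Agents\<close>

text \<open>Cancelling the marks of \<open>Agent\<close> against those of \<open>Total\<close>
  checks that the agent exists and writes the leading zeros of the template in the same pass. The
  \<open>need Total\<close> after the loop makes the inequality strict.\<close>

definition header :: "store \<Rightarrow> store" where
  "header = clear Total \<triangleright> span ((=) Mark) Inp Total \<triangleright> expect Hash \<triangleright>
     clear Agent \<triangleright> span ((=) Mark) Inp Agent \<triangleright> expect Hash \<triangleright>
     clear Aux \<triangleright> loop Agent nonempty (need Total \<triangleright> pop Agent \<triangleright> pop Total \<triangleright> push Aux Zero) \<triangleright>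
     need Total \<triangleright> pop Total \<triangleright> push Aux One \<triangleright>
     loop Total nonempty (pop Total \<triangleright> push Aux Zero) \<triangleright> clear Templ \<triangleright> pour Aux Templ"

lemma ptime_header: "ptime header"
  unfolding header_def
  by (intro ptime ptime_loop_slow slow) auto

subsection \<open>Arrival order\<close>

definition ensure :: "store \<Rightarrow> store" where
  "ensure = branch Seen (\<lambda>x. if nonempty x then skip else push Seen Zero)"

lemma ensure_apply [simp]: "ensure s = s(Seen := if s Seen = [] then [Zero] else s Seen)"
  by (auto simp: ensure_def branch_def fun_eq_iff)

definition walk :: "store \<Rightarrow> store" where
  "walk = pop Inp \<triangleright> ensure \<triangleright> mv Seen Aux"

text \<open>A unary index is executed as a walk along \<open>Seen\<close>. The word does not state
  the number of items, so \<open>Seen\<close> is lengthened on demand; a repeated index is found at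
  once, a missing one shows up as a \<open>Zero\<close> that survives until
  \<open>all_one\<close>.\<close>

definition index :: "store \<Rightarrow> store" where
  "index = clear Aux \<triangleright> loop Inp ((=) (Some Mark)) walk \<triangleright> ensure \<triangleright>
     branch Seen (\<lambda>x. (if x = Some One then fail else skip) \<triangleright> pop Seen \<triangleright> push Seen One) \<triangleright>
     pour Aux Seen \<triangleright> expect Comma"

definition all_one :: "store \<Rightarrow> store" where
  "all_one = copy Seen Aux \<triangleright>
     loop Aux nonempty (branch Aux (\<lambda>x. (if x = Some One then skip else fail) \<triangleright> pop Aux))"

definition arrivals :: "store \<Rightarrow> store" where
  "arrivals = clear Seen \<triangleright> loop Inp (before {Hash}) index \<triangleright> expect Hash \<triangleright> all_one"

lemma ptime_ensure [ptime]: "ptime ensure" and slow_ensure [slow]: "slow ensure"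
  unfolding ensure_def by (intro ptime slow)+

lemma walk_apply: "walk s = s(Inp := tl (s Inp), Seen := tl (s Seen),
    Aux := (if s Seen = [] then Zero else hd (s Seen)) # s Aux)"
proof -
  let ?s = "ensure (pop Inp s)"
  have "?s Seen = (if s Seen = [] then Zero else hd (s Seen)) # tl (s Seen)"
    by (cases "s Seen") auto
  then have "mv Seen Aux ?s = ?s(Seen := tl (s Seen),
      Aux := (if s Seen = [] then Zero else hd (s Seen)) # ?s Aux)"
    by (rule mv_Cons) simp
  then show ?thesis
    by (auto simp: walk_def fun_eq_iff)
qed

lemma ptime_walks [ptime]: "ptime (loop Inp ((=) (Some Mark)) walk)"
proof (rule ptime_loop_slow)
  show "ptime walk" "slow walk"
    unfolding walk_def by (intro ptime slow)+
  show "Some Mark = peek (s Inp) \<Longrightarrow> length (walk s Inp) < length (s Inp)" for s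
    by (cases "s Inp") (auto simp: walk_apply)
qed

text \<open>The mark consumed from the input pays for a fresh \<open>Zero\<close>. So the whole
  inner loop does not enlarge the state and may occur in the slow body of the outer one.\<close>

lemma ssize_walk: "Some Mark = peek (s Inp) \<Longrightarrow> ssize (walk s) \<le> ssize s"
  using ssize_upd[of s Inp "tl (s Inp)"]
    ssize_upd[of "s(Inp := tl (s Inp))" Seen "tl (s Seen)"]
    ssize_upd[of "s(Inp := tl (s Inp), Seen := tl (s Seen))" Aux
      "(if s Seen = [] then Zero else hd (s Seen)) # s Aux"]
  by (cases "s Inp"; cases "s Seen") (auto simp: walk_apply)

lemma slow_walks [slow]: "slow (loop Inp ((=) (Some Mark)) walk)"
  unfolding slow_def
proof (intro exI[of _ 0] allI)
  fix s
  have "length (walk s Inp) < length (s Inp)" if "Some Mark = peek (s Inp)" for s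
    using that by (cases "s Inp") (auto simp: walk_apply)
  then have "ssize (loop Inp ((=) (Some Mark)) walk s) \<le> ssize s"
    using ssize_walk by (rule loop_le)
  then show "ssize (loop Inp ((=) (Some Mark)) walk s) \<le> ssize s + 0" by simp
qed

fun steps :: "nat \<Rightarrow> letter list \<Rightarrow> letter list \<times> letter list" where
  "steps 0 xs = ([], xs)"
| "steps (Suc a) xs = (let (us, vs) = steps a (tl xs) in ((if xs = [] then Zero else hd xs) # us, vs))"

lemma walks:
  "loop Inp ((=) (Some Mark)) walk s = s(Inp := dropWhile ((=) Mark) (s Inp),
    Seen := snd (steps (length (takeWhile ((=) Mark) (s Inp))) (s Seen)),
    Aux := rev (fst (steps (length (takeWhile ((=) Mark) (s Inp))) (s Seen))) @ s Aux)"
proof (induction "s Inp" arbitrary: s)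
  case Nil
  note inp = Nil[symmetric]
  show ?case by (auto simp: inp loop_unfold[of _ _ _ s] fun_eq_iff)
next
  case (Cons x xs)
  note inp = Cons.hyps(2)[symmetric]
  show ?case
  proof (cases "x = Mark")
    case True
    have "walk s Inp = xs" by (simp add: walk_apply inp)
    note IH = Cons.hyps(1)[of "walk s", OF this[symmetric]]
    have loop: "loop Inp ((=) (Some Mark)) walk s = loop Inp ((=) (Some Mark)) walk (walk s)"
      by (simp add: loop_unfold[of _ _ _ s] inp True)
    show ?thesis
      unfolding loop IH by (auto simp: inp True walk_apply fun_eq_iff split: prod.splits)
  next
    case False
    then show ?thesis by (auto simp: inp loop_unfold[of _ _ _ s] fun_eq_iff)
  qed
qed

definition marked :: "nat \<Rightarrow> letter list \<Rightarrow> letter list" where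
  "marked a xs = fst (steps a xs) @ One # tl (snd (steps a xs))"

definition seen :: "letter list \<Rightarrow> nat set" where
  "seen xs = {j. j < length xs \<and> xs ! j = One}"

lemma seen_simps [simp]:
  "seen [] = {}"
  "seen (x # xs) = (if x = One then {0} else {}) \<union> Suc ` seen xs"
proof -
  show "seen (x # xs) = (if x = One then {0} else {}) \<union> Suc ` seen xs"
  proof (rule set_eqI)
    show "j \<in> seen (x # xs) \<longleftrightarrow> j \<in> (if x = One then {0} else {}) \<union> Suc ` seen xs" for j
      by (cases j) (auto simp: seen_def)
  qed
qed (simp add: seen_def)

lemma marked_simps [simp]:
  "marked 0 xs = One # tl xs"
  "marked (Suc a) xs = (if xs = [] then Zero else hd xs) # marked a (tl xs)"
  by (auto simp: marked_def split: prod.splits)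

lemma seen_marked: "seen (marked a xs) = insert a (seen xs)"
proof (induction a arbitrary: xs)
  case 0
  show ?case by (cases xs) auto
next
  case (Suc a)
  show ?case using Suc[of "tl xs"] by (cases xs) auto
qed

lemma length_marked: "length (marked a xs) = max (length xs) (Suc a)"
proof (induction a arbitrary: xs)
  case 0
  show ?case by (cases xs) auto
next
  case (Suc a)
  show ?case using Suc[of "tl xs"] by (cases xs) auto
qed

lemma peek_steps: "peek (snd (steps a xs)) = Some One \<longleftrightarrow> a \<in> seen xs"
proof (induction a arbitrary: xs)
  case 0
  show ?case by (cases xs) auto
next
  case (Suc a)
  show ?case using Suc[of "tl xs"] by (cases xs) (auto split: prod.splits)
qed

lemma index_apply:
  fixes s
  defines "a \<equiv> length (takeWhile ((=) Mark) (s Inp))" and "y \<equiv> dropWhile ((=) Mark) (s Inp)"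
  shows "index s = s(Inp := tl y, Seen := marked a (s Seen), Aux := [],
    Err := if a \<notin> seen (s Seen) \<and> peek y = Some Comma then s Err else [Mark])"
proof -
  let ?t = "snd (steps a (s Seen))"
  have "peek (if ?t = [] then [Zero] else ?t) = Some One \<longleftrightarrow> a \<in> seen (s Seen)"
    using peek_steps[of a "s Seen"] by (cases ?t) auto
  moreover have "tl (if ?t = [] then [Zero] else ?t) = tl ?t"
    by auto
  ultimately show ?thesis
    by (auto simp: index_def walks branch_def marked_def a_def[symmetric] y_def[symmetric] fun_eq_iff)
qed

lemma index_decrease: "before {Hash} (peek (s Inp)) \<Longrightarrow> length (index s Inp) < length (s Inp)"
proof -
  assume "before {Hash} (peek (s Inp))"
  then obtain x xs where s: "s Inp = x # xs" by (cases "s Inp") auto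
  show ?thesis
    using length_dropWhile_le[of "(=) Mark" xs] by (auto simp: index_apply s)
qed

lemma ptime_indices [ptime]: "ptime (loop Inp (before {Hash}) index)"
proof (rule ptime_loop_slow)
  show "ptime index" "slow index"
    unfolding index_def by (intro ptime slow; simp)+
qed (rule index_decrease)

lemma ptime_all_one [ptime]: "ptime all_one"
  unfolding all_one_def
  by (intro ptime ptime_loop_slow slow) (auto simp: branch_def)

lemma ptime_arrivals: "ptime arrivals"
  unfolding arrivals_def by (intro ptime)

lemma all_one_apply:
  "all_one s = s(Tmp := [], Aux := [], Err := if set (s Seen) \<subseteq> {One} then s Err else [Mark])"
proof -
  let ?F = "branch Aux (\<lambda>x. (if x = Some One then skip else fail) \<triangleright> pop Aux)"
  have "loop Aux nonempty ?F s = s(Aux := [], Err := if set (s Aux) \<subseteq> {One} then s Err else [Mark])" for s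
  proof (induction "s Aux" arbitrary: s)
    case Nil
    note aux = Nil[symmetric]
    show ?case by (auto simp: aux fun_eq_iff)
  next
    case (Cons x xs)
    note aux = Cons.hyps(2)[symmetric]
    have F: "?F s = s(Aux := xs, Err := if x = One then s Err else [Mark])"
      by (auto simp: branch_def aux fun_eq_iff)
    then have "?F s Aux = xs" by simp
    note IH = Cons.hyps(1)[of "?F s", OF this[symmetric]]
    have loop: "loop Aux nonempty ?F s = loop Aux nonempty ?F (?F s)"
      by (simp add: loop_unfold[of _ _ _ s] aux)
    show ?case unfolding loop IH unfolding F by (auto simp: aux fun_eq_iff)
  qed
  then show ?thesis by (auto simp: all_one_def fun_eq_iff)
qed

subsection \<open>Utilities\<close>

text \<open>A denominator containing \<open>One\<close> is positive and in particular non-empty, so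
  only the numerator is tested for emptiness.\<close>

definition read_frac :: "store \<Rightarrow> store" where
  "read_frac = clear Numer \<triangleright> span digit Inp Numer \<triangleright> need Numer \<triangleright> expect Slash \<triangleright>
     clear Denom \<triangleright> span digit Inp Denom \<triangleright> has_one Denom \<triangleright> need Flag"

lemma ptime_read_frac [ptime]: "ptime read_frac" and slow_read_frac [slow]: "slow read_frac"
  unfolding read_frac_def by (intro ptime slow; simp)+

definition num_part :: "letter list \<Rightarrow> letter list" where
  "num_part xs = takeWhile digit xs"

definition den_part :: "letter list \<Rightarrow> letter list" where
  "den_part xs = takeWhile digit (tl (dropWhile digit xs))"

definition after_frac :: "letter list \<Rightarrow> letter list" where
  "after_frac xs = dropWhile digit (tl (dropWhile digit xs))"

definition frac_ok :: "letter list \<Rightarrow> bool" where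
  "frac_ok xs \<longleftrightarrow> num_part xs \<noteq> [] \<and> peek (dropWhile digit xs) = Some Slash \<and> One \<in> set (den_part xs)"

lemma read_frac_apply [simp]:
  "read_frac s = s(Inp := after_frac (s Inp), Numer := rev (num_part (s Inp)),
     Denom := rev (den_part (s Inp)), Fac1 := [], Tmp := [], Flag := flag (One \<in> set (den_part (s Inp))),
     Err := if frac_ok (s Inp) then s Err else [Mark])"
  by (auto simp: read_frac_def frac_ok_def num_part_def den_part_def after_frac_def fun_eq_iff)

lemma length_after_frac:
  "length (num_part xs) + length (den_part xs) + length (after_frac xs) \<le> length xs"
proof -
  have "length (takeWhile digit ys) + length (dropWhile digit ys) = length ys" for ys
    by (metis length_append takeWhile_dropWhile_id)
  from this[of xs] this[of "tl (dropWhile digit xs)"] show ?thesis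
    unfolding num_part_def den_part_def after_frac_def by simp
qed

definition column :: "store \<Rightarrow> store" where
  "column = read_frac \<triangleright> expect Comma \<triangleright> has_one Numer \<triangleright>
     branch Flag (\<lambda>x. if nonempty x then put Addend One \<triangleright> add Bidders Addend else skip) \<triangleright>
     branch Cols (\<lambda>x. (if nonempty x then skip else fail) \<triangleright> pop Cols \<triangleright>
       (if x = Some One then transfer Numer NumI \<triangleright> transfer Denom DenI else skip))"

lemma ptime_column: "ptime column" and slow_column: "slow column"
  unfolding column_def by (intro ptime slow; simp)+

lemma column_apply:
  "column s Inp = tl (after_frac (s Inp))"
  "column s Err = (if frac_ok (s Inp) \<and> peek (after_frac (s Inp)) = Some Comma \<and> s Cols \<noteq> []
     then s Err else [Mark])"
  "column s Cols = tl (s Cols)"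
  "column s Bidders = (if One \<in> set (num_part (s Inp)) then addl False (s Bidders) [One] else s Bidders)"
  "column s NumI = (if peek (s Cols) = Some One then rev (num_part (s Inp)) else s NumI)"
  "column s DenI = (if peek (s Cols) = Some One then rev (den_part (s Inp)) else s DenI)"
  "r \<in> {Templ, Seen, SumN, SumD} \<Longrightarrow> column s r = s r"
  by (auto simp: column_def branch_def)

lemma column_decrease: "before {Semicolon, Hash} (peek (s Inp)) \<Longrightarrow> length (column s Inp) < length (s Inp)"
proof -
  assume "before {Semicolon, Hash} (peek (s Inp))"
  then have "s Inp \<noteq> []" by (rule before_Cons)
  then show ?thesis
    using length_after_frac[of "s Inp"] by (cases "after_frac (s Inp)") (auto simp: column_apply)
qed

abbreviation columns :: "store \<Rightarrow> store" where
  "columns \<equiv> loop Inp (before {Semicolon, Hash}) column"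

lemma ptime_columns [ptime]: "ptime columns"
  by (rule ptime_loop_slow[OF ptime_column slow_column column_decrease])

lemma columns_same: "r \<in> {Templ, Seen, SumN, SumD} \<Longrightarrow> columns s r = s r"
  by (rule loop_same[where m = "\<lambda>s. s r"], erule column_decrease) (auto simp: column_apply)

text \<open>The consumed input pays. One more bidder costs at most two letters by
  \<open>length_addl\<close> and is counted only for a numerator with at least one letter; a new
  \<open>DenI\<close> is no longer than the denominator just read. So what a row contributes to
  \<open>SumD\<close> is linear in the letters of that row.\<close>

lemma columns_length:
  "length (columns s Bidders) + length (columns s DenI) + 3 * length (columns s Inp) \<le>
   length (s Bidders) + length (s DenI) + 3 * length (s Inp)"
proof (rule loop_le[where m = "\<lambda>s. length (s Bidders) + length (s DenI) + 3 * length (s Inp)"])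
  fix s :: store
  have "length (column s Bidders) \<le> length (s Bidders) + 2 * length (num_part (s Inp))"
  proof (cases "One \<in> set (num_part (s Inp))")
    case True
    then have "length (num_part (s Inp)) > 0" by auto
    moreover have "length (column s Bidders) \<le> length (s Bidders) + 2"
      using length_addl[of False "s Bidders" "[One]"] by (simp add: column_apply True)
    ultimately show ?thesis by linarith
  qed (simp add: column_apply)
  moreover have "length (column s DenI) \<le> length (s DenI) + length (den_part (s Inp))"
    by (simp add: column_apply)
  ultimately show "length (column s Bidders) + length (column s DenI) + 3 * length (column s Inp) \<le>
     length (s Bidders) + length (s DenI) + 3 * length (s Inp)"
    using length_after_frac[of "s Inp"] by (simp add: column_apply)
qed (rule column_decrease)

definition row_start :: "store \<Rightarrow> store" where
  "row_start = clear NumI \<triangleright> clear DenI \<triangleright> clear Bidders \<triangleright> copy Templ Cols"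

definition row_end :: "store \<Rightarrow> store" where
  "row_end = expect Semicolon \<triangleright> need_empty Cols \<triangleright> need Seen \<triangleright> pop Seen \<triangleright> has_one NumI"

text \<open>Addition over the product of the denominators. \<open>NumI\<close> is multiplied by
  \<open>SumD\<close> before \<open>SumD\<close> changes.\<close>

definition add_share :: "store \<Rightarrow> store" where
  "add_share = mul DenI Bidders \<triangleright> mul SumN DenI \<triangleright> mul NumI SumD \<triangleright> add SumN NumI \<triangleright> mul SumD DenI"

text \<open>The share is skipped when the agent's utility is zero. In that case
  \<open>Bidders\<close> may be 0, and multiplying by it would destroy the positivity of
  \<open>SumD\<close>.\<close>

definition row :: "store \<Rightarrow> store" where
  "row = row_start \<triangleright> columns \<triangleright> row_end \<triangleright> branch Flag (\<lambda>x. if nonempty x then add_share else skip)"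

lemma row_start_apply [simp]:
  "row_start s = s(NumI := [], DenI := [], Bidders := [], Cols := s Templ, Tmp := [])"
  by (auto simp: row_start_def fun_eq_iff)

lemma row_end_apply [simp]:
  "row_end s = s(Inp := tl (s Inp), Seen := tl (s Seen), Fac1 := [], Tmp := [],
     Flag := flag (One \<in> set (s NumI)),
     Err := if peek (s Inp) = Some Semicolon \<and> s Cols = [] \<and> s Seen \<noteq> [] then s Err else [Mark])"
  by (auto simp: row_end_def fun_eq_iff)

lemma add_share_apply:
  fixes s
  defines "q \<equiv> mulacc [] (s DenI) (s Bidders)"
  shows "add_share s = s(DenI := q,
     SumN := addl False (mulacc [] (s SumN) q) (mulacc [] (s NumI) (s SumD)),
     NumI := [], SumD := mulacc [] (s SumD) q,
     Fac1 := [], Fac2 := [], Addend := [], Tmp := [], Flag := [])"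
  by (auto simp: add_share_def q_def fun_eq_iff)

lemma ptime_row: "ptime row"
  unfolding row_def row_start_def row_end_def add_share_def
  by (intro ptime; simp)

text \<open>The product of \<open>DenI\<close> and \<open>Bidders\<close> enters the new
  \<open>DenI\<close>, \<open>SumN\<close> and \<open>SumD\<close>, hence the factor 3. The old
  \<open>SumD\<close> enters both parts of the new sum but is given up only once, hence its
  summand.\<close>

lemma ssize_add_share:
  "ssize (add_share s) \<le>
     ssize s + 3 * (length (s DenI) + length (s Bidders)) + length (s SumD) + 1"
proof -
  have le: "ssize (s(r := [])) \<le> ssize s" for s :: store and r
    using ssize_upd[of s r "[]"] by simp
  define q where "q = mulacc [] (s DenI) (s Bidders)"
  define n where "n = addl False (mulacc [] (s SumN) q) (mulacc [] (s NumI) (s SumD))"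
  define d where "d = mulacc [] (s SumD) q"
  let ?t = "s(DenI := q, SumN := n, NumI := [], SumD := d)"
  have "add_share s = ?t(Fac1 := [], Fac2 := [], Addend := [], Tmp := [], Flag := [])"
    by (simp add: add_share_apply q_def n_def d_def)
  then have "ssize (add_share s) \<le> ssize ?t"
    using le by (metis order_trans)
  moreover have "ssize ?t + length (s DenI) + length (s SumN) + length (s NumI) + length (s SumD) =
      ssize s + length q + length n + length d"
    using ssize_upd[of s DenI q] ssize_upd[of "s(DenI := q)" SumN n]
      ssize_upd[of "s(DenI := q, SumN := n)" NumI "[]"]
      ssize_upd[of "s(DenI := q, SumN := n, NumI := [])" SumD d] by simp
  moreover have "length q \<le> length (s DenI) + length (s Bidders)"
    using length_mulacc[of "[]" "s DenI" "s Bidders"] by (simp add: q_def)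
  moreover have "length d \<le> length (s SumD) + length q"
    using length_mulacc[of "[]" "s SumD" q] by (simp add: d_def)
  moreover have "length n \<le> length (s SumN) + length q + length (s NumI) + length (s SumD) + 1"
    using length_addl[of False "mulacc [] (s SumN) q" "mulacc [] (s NumI) (s SumD)"]
      length_mulacc[of "[]" "s SumN" q] length_mulacc[of "[]" "s NumI" "s SumD"] by (simp add: n_def)
  ultimately show ?thesis by simp
qed

lemma row_decrease: "before {Hash} (peek (s Inp)) \<Longrightarrow> length (row s Inp) < length (s Inp)"
proof -
  assume "before {Hash} (peek (s Inp))"
  then obtain x xs where s: "s Inp = x # xs" "x \<noteq> Hash" by (cases "s Inp") auto
  let ?t = "row_start s"
  have inp: "row s Inp = tl (columns ?t Inp)"
    by (simp add: row_def branch_def add_share_apply)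
  show ?thesis
  proof (cases "x = Semicolon")
    case True
    then show ?thesis
      unfolding inp by (subst loop_unfold) (simp add: s)
  next
    case False
    then have "columns ?t = columns (column ?t)"
      using s by (subst loop_unfold) simp
    moreover have "length (columns (column ?t) Inp) \<le> length (column ?t Inp)"
      by (rule loop_le[where m = "\<lambda>s. length (s Inp)"]) (auto intro: column_decrease less_imp_le)
    moreover have "length (column ?t Inp) < length (?t Inp)"
      using s False by (intro column_decrease) simp
    ultimately show ?thesis unfolding inp by simp
  qed
qed

lemma ptime_rows [ptime]: "ptime (loop Inp (before {Hash}) row)"
proof -
  obtain c where c: "\<And>s. ssize (column s) \<le> ssize s + c"
    using slow_column unfolding slow_def by blast
  have "slow (clear NumI \<triangleright> clear DenI \<triangleright> clear Bidders)" "slow row_end"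
    unfolding row_end_def by (intro slow; simp)+
  then obtain k l where k: "\<And>s. ssize (clear Bidders (clear DenI (clear NumI s))) \<le> ssize s + k"
    and l: "\<And>s. ssize (row_end s) \<le> ssize s + l"
    unfolding slow_def by auto
  \<comment> \<open>A row copies the template and spends at most \<open>c\<close> per column; by
    \<open>columns_length\<close> the share costs up to nine letters per input letter, besides the
    length of \<open>SumD\<close>. The constants \<open>k\<close>, \<open>l\<close> and 1 cover the
    start and the end of the row. Since \<open>SumD\<close> grows by at most three letters per input
    letter consumed, the falling input term pays for it and \<open>g\<close> does not
    increase.\<close>
  define g where "g = (\<lambda>s :: store. length (s Templ) + (c + 9) * length (s Inp) + length (s SumD) + (k + l + 1))"
  show ?thesis
  proof (rule ptime_loop[OF ptime_row, where g = g])
    show "polybd g"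
      unfolding g_def by (intro polybd_add polybd_mult polybd_length polybd_const)
    fix s :: store
    let ?t = "columns (row_start s)"
    have row: "row s = (if One \<in> set (?t NumI) then add_share (row_end ?t) else row_end ?t)"
    proof -
      have "row_end ?t Flag = flag (One \<in> set (?t NumI))" by simp
      then show ?thesis
        by (cases "One \<in> set (?t NumI)")
          (simp_all add: row_def branch_def del: row_end_apply row_start_apply)
    qed
    have same: "?t Templ = s Templ" "?t SumD = s SumD"
      by (simp_all add: columns_same)
    have len: "length (?t Bidders) + length (?t DenI) + 3 * length (?t Inp) \<le> 3 * length (s Inp)"
      using columns_length[of "row_start s"] by simp
    have "ssize (row_start s) \<le> ssize s + k + length (s Templ)"
      using ssize_copy[of Templ Cols "clear Bidders (clear DenI (clear NumI s))"] k[of s]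
      by (simp add: row_start_def)
    moreover have "ssize ?t + c * length (?t Inp) \<le> ssize (row_start s) + c * length (row_start s Inp)"
    proof (rule loop_le[where m = "\<lambda>s. ssize s + c * length (s Inp)"])
      fix s :: store
      assume "before {Semicolon, Hash} (peek (s Inp))"
      then have "Suc (length (column s Inp)) \<le> length (s Inp)" using column_decrease Suc_leI by blast
      then have "c * Suc (length (column s Inp)) \<le> c * length (s Inp)" by (rule mult_le_mono2)
      then show "ssize (column s) + c * length (column s Inp) \<le> ssize s + c * length (s Inp)"
        using c[of s] by simp
    qed (rule column_decrease)
    moreover have "ssize (row s) \<le> ssize ?t + l + 3 * (length (?t DenI) + length (?t Bidders)) + length (?t SumD) + 1"
      using ssize_add_share[of "row_end ?t"] l[of ?t] unfolding row by auto
    ultimately show "ssize (row s) \<le> ssize s + g s"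
      using same len by (simp add: g_def algebra_simps)
    show "g (row s) \<le> g s"
    proof -
      have "row s Templ = s Templ" "length (row s Inp) \<le> length (?t Inp)"
        using same by (simp_all add: row add_share_apply)
      moreover have "length (row s SumD) \<le> length (s SumD) + length (?t Bidders) + length (?t DenI)"
        using length_mulacc[of "[]" "s SumD" "mulacc [] (?t DenI) (?t Bidders)"]
          length_mulacc[of "[]" "?t DenI" "?t Bidders"] same
        by (simp add: row add_share_apply)
      moreover have "(c + 6) * length (?t Inp) \<le> (c + 6) * length (s Inp)"
        using len by (intro mult_le_mono2) simp
      moreover have "(c + 9) * length (row s Inp) \<le> (c + 9) * length (?t Inp)"
        using calculation(2) by (intro mult_le_mono2)
      ultimately show ?thesis
        using len unfolding g_def by (simp add: algebra_simps)
    qed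
  qed (rule row_decrease)
qed

subsection \<open>Threshold\<close>

text \<open>The sum is non-negative, so a threshold with a minus sign is met as soon as it is well
  formed. Otherwise the two fractions are compared by cross-multiplication.\<close>

definition threshold :: "store \<Rightarrow> store" where
  "threshold = expect Hash \<triangleright> need_empty Seen \<triangleright>
     branch Inp (\<lambda>x. if x = Some Minus then pop Inp \<triangleright> read_frac \<triangleright> need_empty Inp
       else read_frac \<triangleright> need_empty Inp \<triangleright> mul SumN Denom \<triangleright> mul Numer SumD \<triangleright>
         compare SumN Numer \<triangleright> need Flag)"

text \<open>Apart from the input all registers start empty: \<open>SumN\<close> then stands for 0
  and \<open>Err\<close> reports no error. Setting \<open>SumD\<close> to 1 makes the initial sum
  0/1.\<close>

definition program :: "store \<Rightarrow> store" where
  "program = header \<triangleright> arrivals \<triangleright> put SumD One \<triangleright> loop Inp (before {Hash}) row \<triangleright> threshold"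

lemma ptime_program: "ptime program"
  unfolding program_def threshold_def
  by (intro ptime ptime_header ptime_arrivals; simp)

section \<open>Correctness of the decision procedure\<close>

subsection \<open>Fractions\<close>

lemma val_pos_iff: "val xs > 0 \<longleftrightarrow> One \<in> set xs"
  by (induction xs) auto

lemma encodes_nat_iff:
  "encodes_nat w n \<longleftrightarrow> w \<noteq> [] \<and> (\<forall>a\<in>set w. digit a) \<and> n = val (rev w)"
proof -
  let ?f = "\<lambda>b. if b then One else Zero"
  have val: "val (map ?f bs) = horner_sum of_bool 2 bs" for bs
    by (induction bs) auto
  show ?thesis
  proof
    assume "encodes_nat w n"
    then obtain bs where "bs \<noteq> []" "w = map ?f bs" "n = horner_sum of_bool 2 (rev bs)"
      unfolding encodes_nat_def by blast
    then show "w \<noteq> [] \<and> (\<forall>a\<in>set w. digit a) \<and> n = val (rev w)"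
      using val[of "rev bs"] by (auto simp: digit_def rev_map)
  next
    assume w: "w \<noteq> [] \<and> (\<forall>a\<in>set w. digit a) \<and> n = val (rev w)"
    then have "w = map ?f (map (\<lambda>a. a = One) w)"
      by (auto simp: digit_def intro!: map_idI[symmetric])
    then show "encodes_nat w n"
      unfolding encodes_nat_def using w val[of "rev (map (\<lambda>a. a = One) w)"]
      by (intro exI[of _ "map (\<lambda>a. a = One) w"]) (metis rev_map map_is_Nil_conv)
  qed
qed

definition frac_val :: "letter list \<Rightarrow> rat" where
  "frac_val xs = of_nat (val (rev (num_part xs))) / of_nat (val (rev (den_part xs)))"

text \<open>A digit at the start of \<open>ys\<close> would be read as part of the denominator.
  \<open>hd []\<close> is unspecified, so the empty rest, which occurs after the threshold, is
  listed separately.\<close>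

lemma num_den_parts:
  assumes "\<forall>a\<in>set u. digit a" "\<forall>a\<in>set v. digit a" "\<not> digit (hd ys) \<or> ys = []"
  shows "num_part (u @ Slash # v @ ys) = u" "dropWhile digit (u @ Slash # v @ ys) = Slash # v @ ys"
    "den_part (u @ Slash # v @ ys) = v" "after_frac (u @ Slash # v @ ys) = ys"
proof -
  have "\<not> digit Slash" by (simp add: digit_def)
  moreover have "takeWhile digit ys = []" "dropWhile digit ys = ys"
    using assms(3) by (cases ys; simp)+
  ultimately show "num_part (u @ Slash # v @ ys) = u" "dropWhile digit (u @ Slash # v @ ys) = Slash # v @ ys"
    "den_part (u @ Slash # v @ ys) = v" "after_frac (u @ Slash # v @ ys) = ys"
    using assms(1,2) by (simp_all add: num_part_def den_part_def after_frac_def)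
qed

lemma frac_sound:
  assumes "frac_ok xs"
  obtains w where "xs = w @ after_frac xs" "encodes_frac w (frac_val xs)"
proof -
  obtain ys where ys: "dropWhile digit xs = Slash # ys"
    using assms unfolding frac_ok_def by (cases "dropWhile digit xs") auto
  have "xs = num_part xs @ Slash # ys"
    unfolding num_part_def by (metis takeWhile_dropWhile_id ys)
  moreover have "ys = den_part xs @ after_frac xs"
    by (simp add: den_part_def after_frac_def ys)
  ultimately have "xs = (num_part xs @ [Slash] @ den_part xs) @ after_frac xs"
    by (metis append_Cons append_assoc append_Nil)
  moreover have "encodes_nat (num_part xs) (val (rev (num_part xs)))"
    "encodes_nat (den_part xs) (val (rev (den_part xs)))" "val (rev (den_part xs)) > 0"
    using assms unfolding encodes_nat_iff val_pos_iff frac_ok_def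
    by (auto simp: num_part_def den_part_def dest: set_takeWhileD)
  then have "encodes_frac (num_part xs @ [Slash] @ den_part xs) (frac_val xs)"
    unfolding encodes_frac_def frac_val_def by blast
  ultimately show thesis using that by blast
qed

lemma frac_complete:
  assumes "encodes_frac w r" "\<not> digit (hd ys) \<or> ys = []"
  shows "frac_ok (w @ ys)" "after_frac (w @ ys) = ys" "frac_val (w @ ys) = r"
proof -
  from assms(1) obtain u v where w: "w = u @ [Slash] @ v" "u \<noteq> []" "\<forall>a\<in>set u. digit a"
    "\<forall>a\<in>set v. digit a" "val (rev v) > 0" "r = of_nat (val (rev u)) / of_nat (val (rev v))"
    unfolding encodes_frac_def encodes_nat_iff by auto
  note parts = num_den_parts[OF w(3,4) assms(2)]
  show "frac_ok (w @ ys)" "after_frac (w @ ys) = ys" "frac_val (w @ ys) = r"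
    using w(2,5) parts unfolding w(1) frac_ok_def frac_val_def w(6) val_pos_iff by auto
qed

lemma frac_ok_den: "frac_ok xs \<Longrightarrow> val (rev (den_part xs)) > 0"
  by (simp add: frac_ok_def val_pos_iff)

lemma frac_ok_pos: "frac_ok xs \<Longrightarrow> frac_val xs > 0 \<longleftrightarrow> One \<in> set (num_part xs)"
  using frac_ok_den[of xs] val_pos_iff[of "rev (num_part xs)"]
  by (auto simp: frac_val_def zero_less_divide_iff)

text \<open>A fraction starts with a digit, hence with neither a delimiter nor \<open>Minus\<close>:
  guards open in front of it and the sign of the threshold is unambiguous.\<close>

lemma encodes_frac_Cons:
  assumes "encodes_frac w r"
  obtains a w' where "w = a # w'" "digit a"
proof -
  obtain u v where "w = u @ v" "u \<noteq> []" "\<forall>a\<in>set u. digit a"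
    using assms unfolding encodes_frac_def encodes_nat_iff by auto
  then show thesis using that by (cases u) auto
qed

lemma encodes_frac_nonneg: "encodes_frac w r \<Longrightarrow> r \<ge> 0"
  unfolding encodes_frac_def by auto

lemma terminated_simps [simp]:
  "terminated x [] = []" "terminated x (w # ws) = w @ x # terminated x ws"
  by (simp_all add: terminated_def)

subsection \<open>Rows\<close>

text \<open>An error once recorded is never erased, so its absence at the end gives its absence in
  every round. Only the syntax is recovered; the values come from \<open>columns_complete\<close>,
  applied to the split found later.\<close>

lemma columns_sound:
  assumes "columns s Err = []"
  shows "s Err = [] \<and> (\<exists>ws rs. list_all2 encodes_frac ws rs \<and> s Inp = terminated Comma ws @ columns s Inp \<and>
    length ws \<le> length (s Cols) \<and> columns s Cols = drop (length ws) (s Cols))"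
proof -
  let ?P = "\<lambda>s s'. s' Err = [] \<longrightarrow> s Err = [] \<and> (\<exists>ws rs. list_all2 encodes_frac ws rs \<and>
    s Inp = terminated Comma ws @ s' Inp \<and> length ws \<le> length (s Cols) \<and> s' Cols = drop (length ws) (s Cols))"
  have "?P s (columns s)"
  proof (induction rule: loop_induct[where P = ?P and r = Inp and b = "before {Semicolon, Hash}" and F = column])
    case (decrease s)
    then show ?case by (rule column_decrease)
  next
    case (stop s)
    show ?case by (auto intro!: exI[of _ "[]"])
  next
    case (step s)
    let ?s' = "columns (column s)"
    show ?case
    proof
      assume "?s' Err = []"
      with step obtain ws rs where ws: "column s Err = []" "list_all2 encodes_frac ws rs"
        "column s Inp = terminated Comma ws @ ?s' Inp" "length ws \<le> length (column s Cols)"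
        "?s' Cols = drop (length ws) (column s Cols)" by blast
      then have ok: "frac_ok (s Inp)" "peek (after_frac (s Inp)) = Some Comma" "s Cols \<noteq> []" "s Err = []"
        by (auto simp: column_apply split: if_splits)
      obtain w where w: "s Inp = w @ after_frac (s Inp)" "encodes_frac w (frac_val (s Inp))"
        using frac_sound[OF ok(1)] by blast
      have "after_frac (s Inp) = Comma # column s Inp"
        using ok(2) by (cases "after_frac (s Inp)") (auto simp: column_apply)
      then have "s Inp = terminated Comma (w # ws) @ ?s' Inp"
        using w(1) ws(3) by simp
      moreover have "length (w # ws) \<le> length (s Cols)" "?s' Cols = drop (length (w # ws)) (s Cols)"
        using ws(4,5) ok(3) by (cases "s Cols"; simp add: column_apply)+
      moreover have "list_all2 encodes_frac (w # ws) (frac_val (s Inp) # rs)"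
        using w(2) ws(2) by simp
      ultimately show "s Err = [] \<and> (\<exists>ws rs. list_all2 encodes_frac ws rs \<and> s Inp = terminated Comma ws @ ?s' Inp \<and>
          length ws \<le> length (s Cols) \<and> ?s' Cols = drop (length ws) (s Cols))"
        using ok(4) by blast
    qed
  qed
  then show ?thesis using assms by blast
qed

text \<open>Every \<open>One\<close> in \<open>Cols\<close> overwrites \<open>NumI\<close> and
  \<open>DenI\<close>, so the value asserted belongs to the last one. The clause on unchanged
  registers carries it through the remaining columns.\<close>

lemma columns_complete:
  assumes "list_all2 encodes_frac ws rs" "s Inp = terminated Comma ws @ y"
    "\<not> before {Semicolon, Hash} (peek y)" "length ws \<le> length (s Cols)"
  shows "columns s Err = s Err \<and> columns s Inp = y \<and> columns s Cols = drop (length ws) (s Cols) \<and>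
    val (columns s Bidders) = val (s Bidders) + length (filter (\<lambda>r. r > 0) rs) \<and>
    (One \<notin> set (take (length ws) (s Cols)) \<longrightarrow> columns s NumI = s NumI \<and> columns s DenI = s DenI) \<and>
    (\<forall>i < length ws. s Cols ! i = One \<and> One \<notin> set (drop (Suc i) (s Cols)) \<longrightarrow>
       val (columns s DenI) > 0 \<and> rs ! i = of_nat (val (columns s NumI)) / of_nat (val (columns s DenI)))"
  using assms(1,2,4)
proof (induction ws rs arbitrary: s rule: list_all2_induct)
  case Nil
  then have "columns s = s" using assms(3) by (simp add: loop_unfold[of _ _ _ s])
  then show ?case using Nil by simp
next
  case (Cons w ws r rs)
  let ?z = "Comma # terminated Comma ws @ y"
  have inp: "s Inp = w @ ?z" using Cons.prems(1) by simp
  have "\<not> digit (hd ?z) \<or> ?z = []" by (simp add: digit_def)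
  note frac = frac_complete[OF Cons.hyps(1) this, folded inp]
  obtain c cs where cols: "s Cols = c # cs" "length ws \<le> length cs"
    using Cons.prems(2) by (cases "s Cols") auto
  obtain a w' where "w = a # w'" "digit a" using Cons.hyps(1) by (rule encodes_frac_Cons)
  then have "before {Semicolon, Hash} (peek (s Inp))" by (auto simp: inp digit_def)
  then have loop: "columns s = columns (column s)" by (simp add: loop_unfold[of _ _ _ s])
  have col: "column s Inp = terminated Comma ws @ y" "column s Cols = cs" "column s Err = s Err"
    "val (column s Bidders) = val (s Bidders) + (if r > 0 then 1 else 0)"
    using frac frac_ok_pos[OF frac(1)] by (auto simp: column_apply cols val_addl)
  have numi: "column s NumI = (if c = One then rev (num_part (s Inp)) else s NumI)"
    "column s DenI = (if c = One then rev (den_part (s Inp)) else s DenI)"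
    by (simp_all add: column_apply cols)
  have IH: "columns (column s) Err = column s Err \<and> columns (column s) Inp = y \<and>
    columns (column s) Cols = drop (length ws) (column s Cols) \<and>
    val (columns (column s) Bidders) = val (column s Bidders) + length (filter (\<lambda>r. r > 0) rs) \<and>
    (One \<notin> set (take (length ws) (column s Cols)) \<longrightarrow>
      columns (column s) NumI = column s NumI \<and> columns (column s) DenI = column s DenI) \<and>
    (\<forall>i < length ws. column s Cols ! i = One \<and> One \<notin> set (drop (Suc i) (column s Cols)) \<longrightarrow>
       val (columns (column s) DenI) > 0 \<and>
       rs ! i = of_nat (val (columns (column s) NumI)) / of_nat (val (columns (column s) DenI)))"
    by (rule Cons.IH) (simp_all add: col cols)
  have "val (columns s DenI) > 0 \<and> (r # rs) ! i = of_nat (val (columns s NumI)) / of_nat (val (columns s DenI))"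
    if i: "i < length (w # ws)" "s Cols ! i = One" "One \<notin> set (drop (Suc i) (s Cols))" for i
  proof (cases i)
    case 0
    then have "c = One" "One \<notin> set (take (length ws) cs)"
      using i cols(1) by (auto dest: in_set_takeD)
    then have "columns s NumI = rev (num_part (s Inp))" "columns s DenI = rev (den_part (s Inp))"
      using IH by (simp_all add: loop col numi)
    then show ?thesis
      using 0 frac(3) frac_ok_den[OF frac(1)] by (simp add: frac_val_def)
  next
    case (Suc j)
    then show ?thesis using IH i by (simp add: loop col cols)
  qed
  moreover have "One \<notin> set (take (length (w # ws)) (s Cols)) \<longrightarrow> columns s NumI = s NumI \<and> columns s DenI = s DenI"
    using IH by (simp add: loop col cols numi)
  moreover have "columns s Err = s Err \<and> columns s Inp = y \<and> columns s Cols = drop (length (w # ws)) (s Cols) \<and>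
    val (columns s Bidders) = val (s Bidders) + length (filter (\<lambda>r. r > 0) (r # rs))"
    using IH by (simp add: loop col cols)
  ultimately show ?case by blast
qed

text \<open>For an item without bidders the quotient is 0 by the convention on division by zero,
  which is the right contribution.\<close>

definition share :: "nat \<Rightarrow> rat list \<Rightarrow> rat" where
  "share i rs = rs ! i / of_nat (length (filter (\<lambda>r. r > 0) rs))"

lemma row_other:
  "row s Err = row_end (columns (row_start s)) Err"
  "row s Inp = tl (columns (row_start s) Inp)"
  "row s Seen = tl (s Seen)" "row s Templ = s Templ"
  by (simp_all add: row_def branch_def add_share_apply columns_same)

lemma row_sound:
  assumes "row s Err = []"
  shows "s Err = [] \<and> s Seen \<noteq> [] \<and> (\<exists>ws rs. list_all2 encodes_frac ws rs \<and>
    length ws = length (s Templ) \<and> s Inp = terminated Comma ws @ Semicolon # row s Inp)"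
proof -
  let ?t = "columns (row_start s)"
  have t: "?t Err = []" "peek (?t Inp) = Some Semicolon" "?t Cols = []" "s Seen \<noteq> []"
    using assms by (simp_all add: row_other columns_same split: if_splits)
  obtain ws rs where ws: "s Err = []" "list_all2 encodes_frac ws rs" "s Inp = terminated Comma ws @ ?t Inp"
    "length ws \<le> length (s Templ)" "?t Cols = drop (length ws) (s Templ)"
    using columns_sound[OF t(1)] by auto
  moreover have "?t Inp = Semicolon # row s Inp"
    using t(2) by (cases "?t Inp") (simp_all add: row_other)
  ultimately show ?thesis using t(3,4) by auto
qed

lemma row_complete:
  assumes "list_all2 encodes_frac ws rs" "s Inp = terminated Comma ws @ Semicolon # y"
    "length ws = length (s Templ)" "s Seen \<noteq> []"
    and templ: "s Templ = replicate i Zero @ One # replicate k Zero"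
    and pos: "val (s SumD) > 0"
  shows "row s Err = s Err \<and> row s Inp = y \<and> val (row s SumD) > 0 \<and>
    (of_nat (val (row s SumN)) / of_nat (val (row s SumD)) :: rat) =
    of_nat (val (s SumN)) / of_nat (val (s SumD)) + share i rs"
proof -
  let ?t = "columns (row_start s)" and ?v = "length (filter (\<lambda>r. r > 0) rs)"
  have C: "?t Err = s Err \<and> ?t Inp = Semicolon # y \<and> ?t Cols = [] \<and> val (?t Bidders) = ?v \<and>
    (\<forall>j < length ws. s Templ ! j = One \<and> One \<notin> set (drop (Suc j) (s Templ)) \<longrightarrow>
       val (?t DenI) > 0 \<and> rs ! j = of_nat (val (?t NumI)) / of_nat (val (?t DenI)))"
    using columns_complete[of ws rs "row_start s" "Semicolon # y"] assms(1-3) by simp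
  have i: "i < length ws" "s Templ ! i = One" "One \<notin> set (drop (Suc i) (s Templ))"
    unfolding assms(3) templ by (simp_all add: nth_append)
  with C have den: "val (?t DenI) > 0" and rsi: "rs ! i = of_nat (val (?t NumI)) / of_nat (val (?t DenI))"
    by blast+
  have err: "row s Err = s Err" "row s Inp = y"
    using C assms(4) by (simp_all add: row_other columns_same)
  show ?thesis
  proof (cases "One \<in> set (?t NumI)")
    case True
    then have num: "val (?t NumI) > 0" by (simp add: val_pos_iff)
    then have "rs ! i > 0" using den rsi by simp
    moreover have "i < length rs" using i(1) assms(1) by (simp add: list_all2_lengthD)
    \<comment> \<open>The positive entry at position \<open>i\<close> is itself counted, so the new
      denominator is non-zero.\<close>
    ultimately have v: "?v > 0"
      by (metis (no_types, lifting) length_greater_0_conv filter_empty_conv nth_mem)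
    have row: "row s = add_share (row_end ?t)"
      using True by (simp add: row_def branch_def)
    have D: "val (row s SumD) = val (s SumD) * (val (?t DenI) * ?v)"
      using C by (simp add: row add_share_apply val_mulacc columns_same)
    have N: "val (row s SumN) = val (s SumN) * (val (?t DenI) * ?v) + val (?t NumI) * val (s SumD)"
      using C by (simp add: row add_share_apply val_mulacc val_addl columns_same)
    show ?thesis
      using err pos den v unfolding D N share_def rsi by (auto simp: field_simps)
  next
    case False
    then have "val (?t NumI) = 0" using val_pos_iff by blast
    then have "share i rs = 0" by (simp add: share_def rsi)
    moreover have "row s SumN = s SumN" "row s SumD = s SumD"
      using False by (simp_all add: row_def branch_def columns_same)
    ultimately show ?thesis using err pos by simp
  qed
qed

abbreviation rows :: "store \<Rightarrow> store" where
  "rows \<equiv> loop Inp (before {Hash}) row"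

lemma rows_sound:
  assumes "rows s Err = []"
  shows "s Err = [] \<and> (\<exists>wss rss. list_all2 (list_all2 encodes_frac) wss rss \<and>
    (\<forall>ws\<in>set wss. length ws = length (s Templ)) \<and>
    s Inp = terminated Semicolon (map (terminated Comma) wss) @ rows s Inp \<and>
    length wss \<le> length (s Seen) \<and> rows s Seen = drop (length wss) (s Seen))"
proof -
  let ?P = "\<lambda>s s'. s' Err = [] \<longrightarrow> s Err = [] \<and> (\<exists>wss rss. list_all2 (list_all2 encodes_frac) wss rss \<and>
    (\<forall>ws\<in>set wss. length ws = length (s Templ)) \<and>
    s Inp = terminated Semicolon (map (terminated Comma) wss) @ s' Inp \<and>
    length wss \<le> length (s Seen) \<and> s' Seen = drop (length wss) (s Seen))"
  have "?P s (rows s)"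
  proof (induction rule: loop_induct[where P = ?P and r = Inp and b = "before {Hash}" and F = row])
    case (decrease s)
    then show ?case by (rule row_decrease)
  next
    case (stop s)
    show ?case by (auto intro!: exI[of _ "[]"])
  next
    case (step s)
    let ?s' = "rows (row s)"
    show ?case
    proof
      assume "?s' Err = []"
      with step obtain wss rss where wss: "row s Err = []" "list_all2 (list_all2 encodes_frac) wss rss"
        "\<forall>ws\<in>set wss. length ws = length (s Templ)"
        "row s Inp = terminated Semicolon (map (terminated Comma) wss) @ ?s' Inp"
        "length wss \<le> length (row s Seen)" "?s' Seen = drop (length wss) (row s Seen)"
        unfolding row_other by blast
      obtain ws rs where ws: "s Err = []" "s Seen \<noteq> []" "list_all2 encodes_frac ws rs"
        "length ws = length (s Templ)" "s Inp = terminated Comma ws @ Semicolon # row s Inp"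
        using row_sound[OF wss(1)] by blast
      have "s Inp = terminated Semicolon (map (terminated Comma) (ws # wss)) @ ?s' Inp"
        using ws(5) wss(4) by simp
      moreover have "length (ws # wss) \<le> length (s Seen)" "?s' Seen = drop (length (ws # wss)) (s Seen)"
        using wss(5,6) ws(2) by (cases "s Seen"; simp add: row_other)+
      moreover have "list_all2 (list_all2 encodes_frac) (ws # wss) (rs # rss)"
        using ws(3) wss(2) by simp
      moreover have "\<forall>us\<in>set (ws # wss). length us = length (s Templ)"
        using wss(3) ws(4) by simp
      ultimately show "s Err = [] \<and> (\<exists>wss rss. list_all2 (list_all2 encodes_frac) wss rss \<and>
          (\<forall>ws\<in>set wss. length ws = length (s Templ)) \<and>
          s Inp = terminated Semicolon (map (terminated Comma) wss) @ ?s' Inp \<and>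
          length wss \<le> length (s Seen) \<and> ?s' Seen = drop (length wss) (s Seen))"
        using ws(1) by blast
    qed
  qed
  then show ?thesis using assms by blast
qed

lemma rows_complete:
  assumes "list_all2 (list_all2 encodes_frac) wss rss"
    "\<forall>ws\<in>set wss. length ws = length (s Templ)"
    "s Inp = terminated Semicolon (map (terminated Comma) wss) @ y" "\<not> before {Hash} (peek y)"
    "length wss \<le> length (s Seen)"
    "s Templ = replicate i Zero @ One # replicate k Zero" "val (s SumD) > 0"
  shows "rows s Err = s Err \<and> rows s Inp = y \<and> rows s Seen = drop (length wss) (s Seen) \<and>
    val (rows s SumD) > 0 \<and> (of_nat (val (rows s SumN)) / of_nat (val (rows s SumD)) :: rat) =
    of_nat (val (s SumN)) / of_nat (val (s SumD)) + sum_list (map (share i) rss)"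
  using assms(1,2,3,5,6,7)
proof (induction wss rss arbitrary: s rule: list_all2_induct)
  case Nil
  then have "rows s = s" using assms(4) by (simp add: loop_unfold[of _ _ _ s])
  then show ?case using Nil by simp
next
  case (Cons ws wss rs rss)
  let ?z = "terminated Semicolon (map (terminated Comma) wss) @ y"
  have inp: "s Inp = terminated Comma ws @ Semicolon # ?z" using Cons.prems(2) by simp
  have "before {Hash} (peek (s Inp))"
  proof (cases ws)
    case Nil
    then show ?thesis by (simp add: inp)
  next
    case (Cons w us)
    then obtain r where "encodes_frac w r" using Cons.hyps(1) by (auto simp: list_all2_Cons1)
    then obtain a w' where "w = a # w'" "digit a" by (rule encodes_frac_Cons)
    then show ?thesis by (auto simp: inp Cons digit_def)
  qed
  then have loop: "rows s = rows (row s)" by (simp add: loop_unfold[of _ _ _ s])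
  have seen: "s Seen \<noteq> []" using Cons.prems(3) by auto
  have row: "row s Err = s Err \<and> row s Inp = ?z \<and> val (row s SumD) > 0 \<and>
    (of_nat (val (row s SumN)) / of_nat (val (row s SumD)) :: rat) =
    of_nat (val (s SumN)) / of_nat (val (s SumD)) + share i rs"
    using Cons.prems seen by (intro row_complete[of ws rs s, OF Cons.hyps(1) inp]) auto
  have "rows (row s) Err = row s Err \<and> rows (row s) Inp = y \<and>
    rows (row s) Seen = drop (length wss) (row s Seen) \<and>
    val (rows (row s) SumD) > 0 \<and> (of_nat (val (rows (row s) SumN)) / of_nat (val (rows (row s) SumD)) :: rat) =
    of_nat (val (row s SumN)) / of_nat (val (row s SumD)) + sum_list (map (share i) rss)"
    using Cons.prems row seen by (intro Cons.IH) (auto simp: row_other Suc_le_eq)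
  then show ?case
    using row seen unfolding loop by (cases "s Seen") (auto simp: row_other)
qed

subsection \<open>Agents, arrival order and threshold\<close>

lemma takeWhile_Mark: "takeWhile ((=) Mark) xs = unary (length (takeWhile ((=) Mark) xs))"
  unfolding unary_def by (induction xs) auto

lemma unary_append:
  assumes "a \<noteq> Mark"
  shows "takeWhile ((=) Mark) (unary n @ a # ys) = unary n" "dropWhile ((=) Mark) (unary n @ a # ys) = a # ys"
  using assms by (induction n) (simp_all add: unary_def)

lemma length_unary [simp]: "length (unary n) = n"
  by (simp add: unary_def)

lemma agent_loop:
  "loop Agent nonempty (need Total \<triangleright> pop Agent \<triangleright> pop Total \<triangleright> push Aux Zero) s =
   s(Agent := [], Total := drop (length (s Agent)) (s Total),
     Aux := replicate (length (s Agent)) Zero @ s Aux,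
     Err := if length (s Agent) \<le> length (s Total) then s Err else [Mark])"
proof (induction "s Agent" arbitrary: s)
  case Nil
  note agent = Nil[symmetric]
  show ?case by (auto simp: agent fun_eq_iff)
next
  case (Cons x xs)
  note agent = Cons.hyps(2)[symmetric]
  let ?F = "need Total \<triangleright> pop Agent \<triangleright> pop Total \<triangleright> push Aux Zero"
  have "?F s Agent = xs" by (simp add: agent)
  note IH = Cons.hyps(1)[of "?F s", OF this[symmetric]]
  have loop: "loop Agent nonempty ?F s = loop Agent nonempty ?F (?F s)"
    by (simp add: loop_unfold[of _ _ _ s] agent)
  show ?case unfolding loop IH
    by (cases "s Total") (auto simp: agent fun_eq_iff replicate_app_Cons_same)
qed

lemma total_loop:
  "loop Total nonempty (pop Total \<triangleright> push Aux Zero) s =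
   s(Total := [], Aux := replicate (length (s Total)) Zero @ s Aux)"
proof (induction "s Total" arbitrary: s)
  case Nil
  note total = Nil[symmetric]
  show ?case by (auto simp: total fun_eq_iff)
next
  case (Cons x xs)
  note total = Cons.hyps(2)[symmetric]
  let ?F = "pop Total \<triangleright> push Aux Zero"
  have "?F s Total = xs" by (simp add: total)
  note IH = Cons.hyps(1)[of "?F s", OF this[symmetric]]
  have loop: "loop Total nonempty ?F s = loop Total nonempty ?F (?F s)"
    by (simp add: loop_unfold[of _ _ _ s] total)
  show ?case unfolding loop IH by (auto simp: total fun_eq_iff replicate_app_Cons_same)
qed

lemma header_apply:
  fixes s
  defines "x1 \<equiv> dropWhile ((=) Mark) (s Inp)"
  defines "n \<equiv> length (takeWhile ((=) Mark) (s Inp))"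
    and "i \<equiv> length (takeWhile ((=) Mark) (tl x1))" and "x2 \<equiv> dropWhile ((=) Mark) (tl x1)"
  shows "header s Inp = tl x2"
    "header s Err = (if peek x1 = Some Hash \<and> peek x2 = Some Hash \<and> i < n then s Err else [Mark])"
    "header s Templ = replicate i Zero @ One # replicate (n - i - 1) Zero"
    "r \<in> {SumN, SumD} \<Longrightarrow> header s r = s r"
  by (auto simp: header_def agent_loop total_loop x1_def n_def i_def x2_def)

lemma header_sound:
  assumes "header s Err = []"
  shows "s Err = [] \<and> (\<exists>n i. i < n \<and> s Inp = unary n @ Hash # unary i @ Hash # header s Inp)"
proof -
  let ?x1 = "dropWhile ((=) Mark) (s Inp)"
  let ?x2 = "dropWhile ((=) Mark) (tl ?x1)"
  let ?n = "length (takeWhile ((=) Mark) (s Inp))" and ?i = "length (takeWhile ((=) Mark) (tl ?x1))"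
  have h: "peek ?x1 = Some Hash" "peek ?x2 = Some Hash" "?i < ?n" "s Err = []"
    using assms by (auto simp: header_apply split: if_splits)
  have "s Inp = unary ?n @ ?x1" "tl ?x1 = unary ?i @ ?x2"
    using takeWhile_Mark by (metis takeWhile_dropWhile_id)+
  moreover have "?x1 = Hash # tl ?x1" using h(1) by (cases ?x1) auto
  moreover have "?x2 = Hash # header s Inp" using h(2) by (cases ?x2) (auto simp: header_apply)
  ultimately have "s Inp = unary ?n @ Hash # unary ?i @ Hash # header s Inp" by metis
  then show ?thesis using h(3,4) by blast
qed

lemma header_complete:
  assumes "s Inp = unary n @ Hash # unary i @ Hash # y" "i < n"
  shows "header s Err = s Err" "header s Inp = y"
    "header s Templ = replicate i Zero @ One # replicate (n - i - 1) Zero"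
  using assms by (simp_all add: header_apply unary_append)

abbreviation indices :: "store \<Rightarrow> store" where
  "indices \<equiv> loop Inp (before {Hash}) index"

lemma indices_sound:
  assumes "indices s Err = []"
  shows "s Err = [] \<and> (\<exists>arr. s Inp = terminated Comma (map unary arr) @ indices s Inp \<and> distinct arr \<and>
    set arr \<inter> seen (s Seen) = {} \<and> seen (indices s Seen) = set arr \<union> seen (s Seen))"
proof -
  let ?P = "\<lambda>s s'. s' Err = [] \<longrightarrow> s Err = [] \<and> (\<exists>arr. s Inp = terminated Comma (map unary arr) @ s' Inp \<and>
    distinct arr \<and> set arr \<inter> seen (s Seen) = {} \<and> seen (s' Seen) = set arr \<union> seen (s Seen))"
  have "?P s (indices s)"
  proof (induction rule: loop_induct[where P = ?P and r = Inp and b = "before {Hash}" and F = index])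
    case (decrease s)
    then show ?case by (rule index_decrease)
  next
    case (stop s)
    show ?case by (auto intro!: exI[of _ "[]"])
  next
    case (step s)
    let ?s' = "indices (index s)"
    let ?a = "length (takeWhile ((=) Mark) (s Inp))" and ?y = "dropWhile ((=) Mark) (s Inp)"
    show ?case
    proof
      assume "?s' Err = []"
      with step obtain arr where arr: "index s Err = []" "index s Inp = terminated Comma (map unary arr) @ ?s' Inp"
        "distinct arr" "set arr \<inter> seen (index s Seen) = {}" "seen (?s' Seen) = set arr \<union> seen (index s Seen)"
        by blast
      have ok: "?a \<notin> seen (s Seen)" "peek ?y = Some Comma" "s Err = []"
        using arr(1) by (auto simp: index_apply split: if_splits)
      have "s Inp = unary ?a @ ?y" using takeWhile_Mark by (metis takeWhile_dropWhile_id)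
      moreover have "?y = Comma # index s Inp"
        using ok(2) by (cases ?y) (auto simp: index_apply)
      ultimately have "s Inp = terminated Comma (map unary (?a # arr)) @ ?s' Inp"
        using arr(2) by simp
      moreover have "distinct (?a # arr)" "set (?a # arr) \<inter> seen (s Seen) = {}"
        "seen (?s' Seen) = set (?a # arr) \<union> seen (s Seen)"
        using arr(3-5) ok(1) by (auto simp: index_apply seen_marked)
      ultimately show "s Err = [] \<and> (\<exists>arr. s Inp = terminated Comma (map unary arr) @ ?s' Inp \<and>
          distinct arr \<and> set arr \<inter> seen (s Seen) = {} \<and> seen (?s' Seen) = set arr \<union> seen (s Seen))"
        using ok(3) by blast
    qed
  qed
  then show ?thesis using assms by blast
qed

text \<open>\<open>Seen\<close> is never lengthened beyond the largest index read. If all indices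
  below \<open>m\<close> occur, the bound forces its length to be exactly \<open>m\<close>, so no
  \<open>Zero\<close> is left.\<close>

lemma indices_complete:
  assumes "s Inp = terminated Comma (map unary arr) @ Hash # y" "distinct arr"
    "set arr \<inter> seen (s Seen) = {}" "set arr \<subseteq> {..<m}" "length (s Seen) \<le> m"
  shows "indices s Err = s Err \<and> indices s Inp = Hash # y \<and> seen (indices s Seen) = set arr \<union> seen (s Seen) \<and>
    length (indices s Seen) \<le> m"
  using assms
proof (induction arr arbitrary: s)
  case Nil
  then show ?case by (simp add: loop_unfold[of _ _ _ s])
next
  case (Cons a arr)
  let ?z = "terminated Comma (map unary arr) @ Hash # y"
  have inp: "s Inp = unary a @ Comma # ?z" using Cons.prems(1) by simp
  have "before {Hash} (peek (s Inp))" by (cases a) (simp_all add: inp unary_def)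
  then have loop: "indices s = indices (index s)" by (simp add: loop_unfold[of _ _ _ s])
  have idx: "index s Inp = ?z" "index s Err = s Err" "index s Seen = marked a (s Seen)"
    using Cons.prems(3) by (simp_all add: index_apply inp unary_append)
  have "indices (index s) Err = index s Err \<and> indices (index s) Inp = Hash # y \<and>
    seen (indices (index s) Seen) = set arr \<union> seen (index s Seen) \<and> length (indices (index s) Seen) \<le> m"
    using Cons.prems by (intro Cons.IH) (auto simp: idx seen_marked length_marked)
  then show ?case by (auto simp: loop idx seen_marked)
qed

lemma all_One_iff: "set xs \<subseteq> {One} \<longleftrightarrow> seen xs = {..<length xs}"
  by (auto simp: seen_def set_conv_nth)

lemma arrivals_apply:
  fixes s
  defines "t \<equiv> indices (s(Seen := []))"
  shows "arrivals s Inp = tl (t Inp)" "arrivals s Seen = t Seen"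
    "arrivals s Err = (if peek (t Inp) = Some Hash \<and> set (t Seen) \<subseteq> {One} then t Err else [Mark])"
  by (auto simp: arrivals_def all_one_apply t_def)

lemma arrivals_same: "r \<in> {Templ, SumN, SumD} \<Longrightarrow> arrivals s r = s r"
proof -
  assume r: "r \<in> {Templ, SumN, SumD}"
  have "indices (s(Seen := [])) r = (s(Seen := [])) r"
    by (rule loop_same[where m = "\<lambda>s. s r"], erule index_decrease) (use r in \<open>auto simp: index_apply\<close>)
  then show ?thesis using r by (auto simp: arrivals_def all_one_apply)
qed

lemma arrivals_sound:
  assumes "arrivals s Err = []"
  shows "s Err = [] \<and> (\<exists>arr. s Inp = terminated Comma (map unary arr) @ Hash # arrivals s Inp \<and>
    distinct arr \<and> set arr = {..<length (arrivals s Seen)})"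
proof -
  let ?t = "indices (s(Seen := []))"
  have t: "peek (?t Inp) = Some Hash" "set (?t Seen) \<subseteq> {One}" "?t Err = []"
    using assms by (auto simp: arrivals_apply split: if_splits)
  have "?t Inp = Hash # arrivals s Inp"
    using t(1) by (cases "?t Inp") (auto simp: arrivals_apply)
  then show ?thesis
    using indices_sound[OF t(3)] t(2) by (auto simp: all_One_iff arrivals_apply)
qed

lemma arrivals_complete:
  assumes "s Inp = terminated Comma (map unary arr) @ Hash # y" "distinct arr" "set arr = {..<m}"
  shows "arrivals s Err = s Err" "arrivals s Inp = y" "length (arrivals s Seen) = m"
proof -
  let ?t = "indices (s(Seen := []))"
  have t: "?t Err = s Err" "?t Inp = Hash # y" "seen (?t Seen) = {..<m}" "length (?t Seen) \<le> m"
    using indices_complete[of "s(Seen := [])" arr y m] assms by auto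
  have "{..<m} \<subseteq> {..<length (?t Seen)}"
    unfolding t(3)[symmetric] by (auto simp: seen_def)
  with t(4) have len: "length (?t Seen) = m" by simp
  then have "set (?t Seen) \<subseteq> {One}" by (simp add: all_One_iff t(3))
  then show "arrivals s Err = s Err" "arrivals s Inp = y" "length (arrivals s Seen) = m"
    using t(1,2) len by (simp_all add: arrivals_apply)
qed

text \<open>\<open>threshold_iff\<close> needs a positive denominator, which is known only once the
  word has been split; this weaker fact suffices to start the splitting.\<close>

lemma threshold_mono: "threshold s Err = [] \<Longrightarrow> s Err = [] \<and> s Seen = []"
  by (auto simp: threshold_def branch_def split: if_splits)

lemma threshold_iff:
  assumes "val (s SumD) > 0"
  shows "threshold s Err = [] \<longleftrightarrow> s Err = [] \<and> s Seen = [] \<and> (\<exists>v t. s Inp = Hash # v \<and> encodes_rat v t \<and>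
    t \<le> of_nat (val (s SumN)) / of_nat (val (s SumD)))"
proof -
  let ?q = "of_nat (val (s SumN)) / of_nat (val (s SumD)) :: rat"
  have q: "0 \<le> ?q" by simp
  let ?v = "tl (s Inp)"
  have eq: "threshold s Err = [] \<longleftrightarrow> s Err = [] \<and> s Seen = [] \<and> peek (s Inp) = Some Hash \<and>
    (if peek ?v = Some Minus then frac_ok (tl ?v) \<and> after_frac (tl ?v) = []
     else frac_ok ?v \<and> after_frac ?v = [] \<and>
       val (rev (num_part ?v)) * val (s SumD) \<le> val (s SumN) * val (rev (den_part ?v)))"
    by (auto simp: threshold_def branch_def val_mulacc split: if_splits)
  have le: "frac_val w \<le> ?q \<longleftrightarrow>
      val (rev (num_part w)) * val (s SumD) \<le> val (s SumN) * val (rev (den_part w))" if "frac_ok w" for w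
  proof -
    have "frac_val w \<le> ?q \<longleftrightarrow> of_nat (val (rev (num_part w)) * val (s SumD)) \<le>
        (of_nat (val (s SumN) * val (rev (den_part w))) :: rat)"
      unfolding frac_val_def using frac_ok_den[OF that] assms
      by (simp add: divide_le_eq le_divide_eq field_simps)
    then show ?thesis by (simp only: of_nat_le_iff)
  qed
  have whole: "(frac_ok w \<and> after_frac w = []) \<longleftrightarrow> encodes_frac w (frac_val w)" for w
    using frac_sound[of w] frac_complete[of w "frac_val w" "[]"] by (metis append_Nil2)
  have unique: "encodes_frac w r \<Longrightarrow> r = frac_val w" for w r
    using frac_complete[of w r "[]"] by simp
  have "(\<exists>t. encodes_rat v t \<and> t \<le> ?q) \<longleftrightarrow> (if peek v = Some Minus then frac_ok (tl v) \<and> after_frac (tl v) = []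
     else frac_ok v \<and> after_frac v = [] \<and>
       val (rev (num_part v)) * val (s SumD) \<le> val (s SumN) * val (rev (den_part v)))" for v
  proof (cases "peek v = Some Minus")
    case True
    then obtain w where v: "v = Minus # w" by (cases v) auto
    then have "\<not> encodes_frac v t" for t
      using encodes_frac_Cons[of v t] by (auto simp: digit_def)
    then have "encodes_rat v t \<longleftrightarrow> encodes_frac w (- t)" for t
      by (simp add: encodes_rat_def v)
    \<comment> \<open>Here \<open>- t\<close> is a fraction, so \<open>t \<le> 0 \<le> ?q\<close>
      and the comparison disappears.\<close>
    then have "(\<exists>t. encodes_rat v t \<and> t \<le> ?q) \<longleftrightarrow> encodes_frac w (frac_val w)"
      using encodes_frac_nonneg[of w] unique[of w] q
      by (metis minus_minus neg_le_0_iff_le order_trans)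
    then show ?thesis using True whole[of w] by (simp add: v)
  next
    case False
    then have "encodes_rat v t \<longleftrightarrow> encodes_frac v t" for t
      by (auto simp: encodes_rat_def)
    then have "(\<exists>t. encodes_rat v t \<and> t \<le> ?q) \<longleftrightarrow> encodes_frac v (frac_val v) \<and> frac_val v \<le> ?q"
      using unique[of v] by metis
    then show ?thesis using False whole[of v] le[of v] by auto
  qed
  moreover have "(\<exists>v t. s Inp = Hash # v \<and> encodes_rat v t \<and> t \<le> ?q) \<longleftrightarrow>
      peek (s Inp) = Some Hash \<and> (\<exists>t. encodes_rat ?v t \<and> t \<le> ?q)"
    by (cases "s Inp") auto
  ultimately show ?thesis unfolding eq by simp
qed

section \<open>The words accepted by the program\<close>

lemma program_iff:
  "program ((\<lambda>_. [])(Inp := w)) Err = [] \<longleftrightarrow> (\<exists>n i arr wss rss v t. i < n \<and>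
     w = unary n @ Hash # unary i @ Hash # terminated Comma (map unary arr) @ Hash #
       terminated Semicolon (map (terminated Comma) wss) @ Hash # v \<and>
     distinct arr \<and> set arr = {..<length rss} \<and> list_all2 (list_all2 encodes_frac) wss rss \<and>
     (\<forall>ws\<in>set wss. length ws = n) \<and> encodes_rat v t \<and> t \<le> sum_list (map (share i) rss))"
proof -
  define s0 where "s0 = (\<lambda>_. [])(Inp := w)"
  define s1 where "s1 = header s0"
  define s2 where "s2 = (arrivals s1)(SumD := [One])"
  define s3 where "s3 = rows s2"
  have prog: "program s0 = threshold s3"
    by (simp add: program_def s1_def s2_def s3_def)
  have init: "s0 Err = []" "s0 Inp = w" "s0 SumN = []" by (simp_all add: s0_def)
  have sumn: "s2 SumN = []" "s2 SumD = [One]" "s2 Templ = s1 Templ"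
    by (simp_all add: s2_def arrivals_same s1_def header_apply init)
  \<comment> \<open>The rest \<open>v\<close> is constrained only by the row loop stopping there. So
    the claim applies to what an accepting run leaves over, before that is known to begin with
    \<open>Hash\<close>, as well as to the rest of a given encoding.\<close>
  have main: "threshold s3 Err = [] \<longleftrightarrow> (\<exists>v' t. v = Hash # v' \<and> encodes_rat v' t \<and> t \<le> sum_list (map (share i) rss))"
    if w: "w = unary n @ Hash # unary i @ Hash # terminated Comma (map unary arr) @ Hash #
       terminated Semicolon (map (terminated Comma) wss) @ v" and "i < n" "distinct arr"
      "set arr = {..<length rss}" "list_all2 (list_all2 encodes_frac) wss rss"
      "\<forall>ws\<in>set wss. length ws = n" "\<not> before {Hash} (peek v)" for n i arr wss rss v
  proof -
    have len: "length wss = length rss" using that(5) by (rule list_all2_lengthD)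
    note h = header_complete[of s0, unfolded init, OF w that(2), folded s1_def]
    have lenT: "length (s1 Templ) = n" using that(2) by (simp add: h)
    note a = arrivals_complete[of s1, OF h(2) that(3,4)]
    have r: "rows s2 Err = s2 Err \<and> rows s2 Inp = v \<and> rows s2 Seen = drop (length wss) (s2 Seen) \<and>
      val (rows s2 SumD) > 0 \<and> (of_nat (val (rows s2 SumN)) / of_nat (val (rows s2 SumD)) :: rat) =
      of_nat (val (s2 SumN)) / of_nat (val (s2 SumD)) + sum_list (map (share i) rss)"
      by (rule rows_complete[OF that(5) _ _ that(7), where k = "n - i - 1"])
        (use that(6) lenT len a h in \<open>simp_all add: sumn\<close>, simp_all add: s2_def)
    have "s3 Err = []" "s3 Seen = []" "s3 Inp = v" "val (s3 SumD) > 0"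
      "(of_nat (val (s3 SumN)) / of_nat (val (s3 SumD)) :: rat) = sum_list (map (share i) rss)"
      using r a h len by (simp_all add: s3_def sumn) (simp_all add: s2_def)
    then show ?thesis using threshold_iff[of s3] by simp
  qed
  show ?thesis
    unfolding s0_def[symmetric] prog
  proof
    assume acc: "threshold s3 Err = []"
    have s3: "rows s2 Err = []" "rows s2 Seen = []"
      using threshold_mono[OF acc] by (simp_all add: s3_def)
    \<comment> \<open>Every row removes one entry of \<open>Seen\<close> and the final test found it
      empty, so there are exactly as many rows as items.\<close>
    from rows_sound[OF s3(1)] s3(2) obtain wss rss where wss: "s2 Err = []"
      "list_all2 (list_all2 encodes_frac) wss rss" "\<forall>ws\<in>set wss. length ws = length (s2 Templ)"
      "s2 Inp = terminated Semicolon (map (terminated Comma) wss) @ rows s2 Inp"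
      "length wss = length (s2 Seen)" by auto
    have len: "length wss = length rss" using wss(2) by (rule list_all2_lengthD)
    have "arrivals s1 Err = []" using wss(1) by (simp add: s2_def)
    from arrivals_sound[OF this] obtain arr where arr: "s1 Err = []"
      "s1 Inp = terminated Comma (map unary arr) @ Hash # s2 Inp" "distinct arr" "set arr = {..<length rss}"
      using wss(5) len by (auto simp: s2_def)
    from header_sound[of s0] arr(1) obtain n i where ni: "i < n" "w = unary n @ Hash # unary i @ Hash # s1 Inp"
      by (auto simp: s1_def init)
    have "length (s1 Templ) = n"
      using header_complete(3)[of s0, unfolded init, OF ni(2,1)] ni(1) by (simp add: s1_def)
    then have lens: "\<forall>ws\<in>set wss. length ws = n" using wss(3) by (simp add: sumn)
    have w: "w = unary n @ Hash # unary i @ Hash # terminated Comma (map unary arr) @ Hash #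
       terminated Semicolon (map (terminated Comma) wss) @ rows s2 Inp"
      using ni(2) arr(2) wss(4) by simp
    have "\<not> before {Hash} (peek (rows s2 Inp))"
      by (rule loop_induct[where P = "\<lambda>_ s. \<not> before {Hash} (peek (s Inp))"]) (auto intro: row_decrease)
    from main[OF w ni(1) arr(3,4) wss(2) lens this] acc obtain v t where
      "rows s2 Inp = Hash # v" "encodes_rat v t" "t \<le> sum_list (map (share i) rss)" by blast
    then show "\<exists>n i arr wss rss v t. i < n \<and>
     w = unary n @ Hash # unary i @ Hash # terminated Comma (map unary arr) @ Hash #
       terminated Semicolon (map (terminated Comma) wss) @ Hash # v \<and>
     distinct arr \<and> set arr = {..<length rss} \<and> list_all2 (list_all2 encodes_frac) wss rss \<and>
     (\<forall>ws\<in>set wss. length ws = n) \<and> encodes_rat v t \<and> t \<le> sum_list (map (share i) rss)"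
      using w ni(1) arr(3,4) wss(2) lens by metis
  next
    assume "\<exists>n i arr wss rss v t. i < n \<and>
     w = unary n @ Hash # unary i @ Hash # terminated Comma (map unary arr) @ Hash #
       terminated Semicolon (map (terminated Comma) wss) @ Hash # v \<and>
     distinct arr \<and> set arr = {..<length rss} \<and> list_all2 (list_all2 encodes_frac) wss rss \<and>
     (\<forall>ws\<in>set wss. length ws = n) \<and> encodes_rat v t \<and> t \<le> sum_list (map (share i) rss)"
    then obtain n i arr wss rss v t where "i < n"
      "w = unary n @ Hash # unary i @ Hash # terminated Comma (map unary arr) @ Hash #
       terminated Semicolon (map (terminated Comma) wss) @ Hash # v"
      "distinct arr" "set arr = {..<length rss}" "list_all2 (list_all2 encodes_frac) wss rss"
      "\<forall>ws\<in>set wss. length ws = n" "encodes_rat v t" "t \<le> sum_list (map (share i) rss)"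
      by blast
    then show "threshold s3 Err = []"
      using main[of n i arr wss "Hash # v" rss] by auto
  qed
qed

section \<open>Expected utilities under the Like mechanism\<close>

lemma finite_bidders: "finite (bidders n v k)"
  unfolding bidders_def by simp

lemma finite_like_run: "finite (set_pmf (like_run n v ks \<pi>))"
proof (induction ks arbitrary: \<pi>)
  case (Cons k ks)
  have "finite (set_pmf (like_item n v k))"
    using finite_bidders[of n v k] by (simp add: like_item_def)
  then show ?case using Cons by simp
qed simp

text \<open>The entry of an item changes only when that item arrives, and by distinctness this
  happens once. So its law is that of \<open>like_item\<close>, wherever the item stands in the
  order.\<close>

lemma like_run_marginal:
  assumes "distinct ks"
  shows "map_pmf (\<lambda>\<pi>. \<pi> k) (like_run n v ks \<pi>) =
    (if k \<in> set ks then like_item n v k else return_pmf (\<pi> k))"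
  using assms
proof (induction ks arbitrary: \<pi>)
  case (Cons a ks)
  then show ?case
    by (cases "k = a") (simp_all add: map_bind_pmf bind_return_pmf')
qed simp

lemma pmf_like_item:
  "pmf (like_item n v k) (Some i) = of_bool (i \<in> bidders n v k) / card (bidders n v k)"
proof (cases "bidders n v k = {}")
  case False
  then show ?thesis
    using finite_bidders[of n v k]
    by (simp add: like_item_def pmf_map_inj' pmf_of_set indicator_def)
qed (simp add: like_item_def)

text \<open>Linearity of expectation: only the marginal law of each item matters, so neither the
  joint distribution nor the arrival order survives.\<close>

lemma expected_utility_like:
  assumes "valid_instance I" "i < agents I"
  shows "expected_utility like I i =
    of_rat (\<Sum>k<items I. util I i k / of_nat (card (bidders (agents I) (util I) k)))"
proof -
  define P where "P = like (agents I) (util I) (arrival I)"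
  have fin: "finite (set_pmf P)"
    unfolding P_def like_def by (rule finite_like_run)
  have arr: "distinct (arrival I)" "set (arrival I) = {..<items I}"
    using assms(1) by (simp_all add: valid_instance_def)
  have prob: "(\<Sum>\<pi>\<in>set_pmf P. of_bool (\<pi> k = Some i) * pmf P \<pi>) =
      of_bool (i \<in> bidders (agents I) (util I) k) / card (bidders (agents I) (util I) k)"
    if "k < items I" for k
  proof -
    \<comment> \<open>Read as the expectation of an indicator, the sum is the probability of
      \<open>Some i\<close> under the marginal law of item \<open>k\<close>.\<close>
    have "(\<Sum>\<pi>\<in>set_pmf P. of_bool (\<pi> k = Some i) * pmf P \<pi>) =
        measure_pmf.expectation P (\<lambda>\<pi>. of_bool (\<pi> k = Some i))"
      using fin by (subst integral_measure_pmf_real[of "set_pmf P"]) auto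
    also have "\<dots> = measure_pmf.expectation P (indicator ((\<lambda>\<pi>. \<pi> k) -` {Some i}))"
      by (rule Bochner_Integration.integral_cong) (auto simp: indicator_def)
    also have "\<dots> = pmf (map_pmf (\<lambda>\<pi>. \<pi> k) P) (Some i)"
      by (simp add: pmf_map)
    also have "map_pmf (\<lambda>\<pi>. \<pi> k) P = like_item (agents I) (util I) k"
      unfolding P_def like_def using arr that by (simp add: like_run_marginal)
    finally show ?thesis by (simp add: pmf_like_item)
  qed
  have share: "of_rat (util I i k) * (of_bool (i \<in> bidders (agents I) (util I) k) / card (bidders (agents I) (util I) k))
      = (of_rat (util I i k / of_nat (card (bidders (agents I) (util I) k))) :: real)"
    if "k < items I" for k
  proof -
    \<comment> \<open>By non-negativity an agent that does not bid has utility 0, which absorbs the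
      indicator.\<close>
    have "util I i k = 0" if "i \<notin> bidders (agents I) (util I) k"
      using assms \<open>k < items I\<close> that unfolding valid_instance_def bidders_def
      by (metis (mono_tags, lifting) mem_Collect_eq order_le_less)
    then show ?thesis by (auto simp: of_rat_divide)
  qed
  have "expected_utility like I i = (\<Sum>\<pi>\<in>set_pmf P. pmf P \<pi> * of_rat (alloc_utility I i \<pi>))"
    by (simp only: expected_utility_def P_def Let_def)
  also have "\<dots> = (\<Sum>\<pi>\<in>set_pmf P. \<Sum>k<items I. of_rat (util I i k) * (of_bool (\<pi> k = Some i) * pmf P \<pi>))"
  proof (rule sum.cong[OF refl])
    fix \<pi>
    have "alloc_utility I i \<pi> = (\<Sum>k<items I. util I i k * of_bool (\<pi> k = Some i))"
      unfolding alloc_utility_def by (rule sum.mono_neutral_cong_left) auto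
    then show "pmf P \<pi> * of_rat (alloc_utility I i \<pi>) =
        (\<Sum>k<items I. of_rat (util I i k) * (of_bool (\<pi> k = Some i) * pmf P \<pi>))"
      by (simp only: of_rat_sum of_rat_mult sum_distrib_left) (rule sum.cong; auto)
  qed
  also have "\<dots> = (\<Sum>k<items I. of_rat (util I i k) * (\<Sum>\<pi>\<in>set_pmf P. of_bool (\<pi> k = Some i) * pmf P \<pi>))"
    by (subst sum.swap) (simp add: sum_distrib_left)
  also have "\<dots> = (\<Sum>k<items I. of_rat (util I i k / of_nat (card (bidders (agents I) (util I) k))))"
    by (rule sum.cong) (simp_all only: prob share lessThan_iff)
  finally show ?thesis by (simp add: of_rat_sum)
qed

lemma sum_list_share:
  assumes "i < n"
  shows "sum_list (map (share i) (map (\<lambda>k. map (\<lambda>j. u j k) [0..<n]) [0..<m])) =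
    (\<Sum>k<m. u i k / of_nat (card (bidders n u k)))"
proof -
  have "length (filter (\<lambda>r. r > 0) (map (\<lambda>j. u j k) [0..<n])) = card (bidders n u k)" for k
    unfolding length_filter_conv_card bidders_def by (rule arg_cong[where f = card]) auto
  then have "share i (map (\<lambda>j. u j k) [0..<n]) = u i k / of_nat (card (bidders n u k))" for k
    using assms by (simp add: share_def)
  then show ?thesis
    by (simp add: comp_def interv_sum_list_conv_sum_set_nat atLeast0LessThan)
qed

lemma necessary_utility_like:
  "necessary_utility like = {w. program ((\<lambda>_. [])(Inp := w)) Err = []}"
proof (intro set_eqI iffI)
  fix w
  assume "w \<in> necessary_utility like"
  then obtain I i t where I: "valid_instance I" "i < agents I" "encodes w I i t"
    "expected_utility like I i \<ge> of_rat t" unfolding necessary_utility_def by blast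
  define rss where "rss = map (\<lambda>k. map (\<lambda>j. util I j k) [0..<agents I]) [0..<items I]"
  obtain wss v where w: "list_all2 (list_all2 encodes_frac) wss rss" "encodes_rat v t"
    "w = unary (agents I) @ Hash # unary i @ Hash # terminated Comma (map unary (arrival I)) @ Hash #
       terminated Semicolon (map (terminated Comma) wss) @ Hash # v"
    using I(3) unfolding encodes_def rss_def by auto
  have "t \<le> sum_list (map (share i) rss)"
    using I(4) unfolding expected_utility_like[OF I(1,2)] rss_def sum_list_share[OF I(2)]
    by (simp only: of_rat_less_eq)
  moreover have "\<forall>ws\<in>set wss. length ws = agents I"
  proof
    fix ws assume "ws \<in> set wss"
    then obtain k where "k < length wss" "ws = wss ! k" by (auto simp: in_set_conv_nth)
    moreover have "length wss = items I"
      using w(1) list_all2_lengthD by (fastforce simp: rss_def)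
    ultimately show "length ws = agents I"
      using list_all2_nthD[OF w(1)] list_all2_lengthD by (fastforce simp: rss_def)
  qed
  moreover have "distinct (arrival I)" "set (arrival I) = {..<length rss}"
    using I(1) by (simp_all add: valid_instance_def rss_def)
  ultimately show "w \<in> {w. program ((\<lambda>_. [])(Inp := w)) Err = []}"
    unfolding mem_Collect_eq program_iff using I(2) w by blast
next
  fix w
  assume "w \<in> {w. program ((\<lambda>_. [])(Inp := w)) Err = []}"
  then obtain n i arr wss rss v t where w: "i < n"
    "w = unary n @ Hash # unary i @ Hash # terminated Comma (map unary arr) @ Hash #
       terminated Semicolon (map (terminated Comma) wss) @ Hash # v"
    "distinct arr" "set arr = {..<length rss}" "list_all2 (list_all2 encodes_frac) wss rss"
    "\<forall>ws\<in>set wss. length ws = n" "encodes_rat v t" "t \<le> sum_list (map (share i) rss)"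
    unfolding mem_Collect_eq program_iff by blast
  \<comment> \<open>Out of range the utilities are whatever \<open>!\<close> returns; validity, the
    encoding and the expected utility inspect only indices in range.\<close>
  define I where "I = \<lparr>agents = n, items = length rss, util = (\<lambda>j k. rss ! k ! j), arrival = arr\<rparr>"
  have len: "length (rss ! k) = n" if "k < length rss" for k
    using w(5,6) that unfolding list_all2_conv_all_nth by (metis nth_mem)
  have rss: "rss = map (\<lambda>k. map (\<lambda>j. util I j k) [0..<agents I]) [0..<items I]"
    by (rule nth_equalityI) (auto simp: I_def len intro!: nth_equalityI)
  have "rss ! k ! j \<ge> 0" if "j < n" "k < length rss" for j k
  proof -
    have "list_all2 encodes_frac (wss ! k) (rss ! k)"
      using w(5) that(2) by (simp add: list_all2_conv_all_nth)
    then have "encodes_frac (wss ! k ! j) (rss ! k ! j)"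
      using that len by (simp add: list_all2_conv_all_nth)
    then show ?thesis by (rule encodes_frac_nonneg)
  qed
  then have valid: "valid_instance I"
    using w(3,4) by (simp add: valid_instance_def I_def)
  have i: "i < agents I" using w(1) by (simp add: I_def)
  have "encodes w I i t"
    unfolding encodes_def rss[symmetric]
    by (rule exI[of _ wss], rule exI[of _ v]) (use w(2,5,7) in \<open>simp add: I_def\<close>)
  moreover have "expected_utility like I i \<ge> of_rat t"
    using w(8) unfolding expected_utility_like[OF valid i] sum_list_share[OF i, symmetric] rss[symmetric]
    by (simp only: of_rat_less_eq)
  ultimately show "w \<in> necessary_utility like"
    unfolding necessary_utility_def using valid i by blast
qed

theorem mainTheorem8:
  shows "in_P (necessary_utility like)"
  unfolding necessary_utility_like by (rule in_P_ptime[OF ptime_program])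

end
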